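(* Let $1<k\le n$ be integers, and let $P=\mathrm{Poset}(\mathrm{PF}_{n,k})$, with minimum $\hat 0$ and maximum $\hat 1$. Then $\mu(P):=\mu_P(\hat 0,\hat 1)=0$.
   Context: The Möbius function $\mu_P:P\times P\to\mathbb{Z}$ of a finite poset $P$ is defined by $\mu_P(x,x)=1$, $\mu_P(x,y)=-\sum_{x\le z<y}\mu_P(x,z)$ if $x<y$, and $\mu_P(x,y)=0$ otherwise. "The Möbius function of $P$", for a bounded poset $P$, means the number $\mu_P(\hat 0,\hat 1)$. Write $[n]=\{1,\dots,n\}$. A parking function of length $n$ is an $n$-tuple $(a_1,\dots,a_n)$ of positive integers whose weakly increasing rearrangement $b_1\le\dots\le b_n$ satisfies $b_i\le i$ for all $i$; $\mathrm{PF}_n$ is the set of these. For $1<k\le n$, $\mathrm{PF}_{n,k}$ is the set of $a\in\mathrm{PF}_n$ such that $k$ is not an entry of $a$ but each of $k+1,\dots,n$ is an entry of $a$. $\mathrm{NC}_m$ is the lattice of noncrossing partitions of $[m]$ (partitions for which, placing $1,\dots,m$ in clockwise order on a circle, the convex hulls of the blocks are pairwise disjoint), ordered by refinement, with the finer partition being smaller. Each covering relation $\sigma<\tau$ in $\mathrm{NC}_{n+1}$ merges two blocks $B_1,B_2$ of $\sigma$ into one block $B=B_1\cup B_2$ of $\tau$; name them so that $\min B\in B_1$, and label the covering relation by the largest element of $B_1$ that is less than every element of $B_2$. Reading the labels of a maximal chain of $\mathrm{NC}_{n+1}$ from bottom to top gives a parking function of length $n$, and this is a (known) bijection from maximal chains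 of $\mathrm{NC}_{n+1}$ to $\mathrm{PF}_n$. $\mathrm{Poset}(\mathrm{PF}_{n,k})$ is the poset whose Hasse diagram is the union of the maximal chains of $\mathrm{NC}_{n+1}$ corresponding to elements of $\mathrm{PF}_{n,k}$: its elements are the noncrossing partitions lying on at least one of these chains, and its order is the reflexive-transitive closure of the covering relations occurring in these chains (it need not be an induced subposet of $\mathrm{NC}_{n+1}$). *)

theory Defs
  imports "HOL-Analysis.Analysis" "HOL-Library.Disjoint_Sets"
begin

text \<open>
  A finite poset is given by its carrier \<open>A\<close> and its (reflexive) order relation \<open>r\<close>. The recursion
  terminates only for finite posets; on anything else the value is left unspecified.
\<close>

function mobius :: "'a set \<Rightarrow> 'a rel \<Rightarrow> 'a \<Rightarrow> 'a \<Rightarrow> int" where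
  "mobius A r x y =
    (if finite A \<and> partial_order_on A r then
       if x = y then 1
       else if (x, y) \<in> r then - (\<Sum>z \<in> {z. (x, z) \<in> r \<and> (z, y) \<in> r \<and> z \<noteq> y}. mobius A r x z)
       else 0
     else undefined)"
  by pat_completeness auto
termination
proof (relation "inv_image less_than (\<lambda>(A, r, x, y). card {z. (z, y) \<in> r})", goal_cases)
  case 1
  then show ?case by simp
next
  case (2 A r x y z)
  then have r: "r \<subseteq> A \<times> A" "refl_on A r" "trans r" "antisym r"
    by (auto simp: partial_order_on_def preorder_on_def)
  have zy: "(z, y) \<in> r" "z \<noteq> y"
    using 2 by auto
  have "{w. (w, z) \<in> r} \<subseteq> {w. (w, y) \<in> r}"
    using zy r(3) by (auto dest: transD)
  moreover have "(y, y) \<in> r"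
    using zy r(1,2) by (auto simp: refl_on_def)
  moreover have "(y, z) \<notin> r"
    using zy r(4) by (auto dest: antisymD)
  ultimately have "{w. (w, z) \<in> r} \<subset> {w. (w, y) \<in> r}"
    by auto
  moreover have "finite {w. (w, y) \<in> r}"
    using r(1) 2(1) by (auto intro: finite_subset[of _ A])
  ultimately show ?case
    by (simp add: psubset_card_mono)
qed

declare mobius.simps [simp del]

definition poset_min :: "'a set \<Rightarrow> 'a rel \<Rightarrow> 'a" where
  "poset_min A r = (THE x. x \<in> A \<and> (\<forall>y\<in>A. (x, y) \<in> r))"

definition poset_max :: "'a set \<Rightarrow> 'a rel \<Rightarrow> 'a" where
  "poset_max A r = (THE x. x \<in> A \<and> (\<forall>y\<in>A. (y, x) \<in> r))"

definition mobius_number :: "'a set \<Rightarrow> 'a rel \<Rightarrow> int" where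
  "mobius_number A r = mobius A r (poset_min A r) (poset_max A r)"

text \<open>Tuples are lists; the entry with index \<open>i\<close> (from 1) is \<open>xs ! (i - 1)\<close>.\<close>

definition PF :: "nat \<Rightarrow> nat list set" where
  "PF n = {a. length a = n \<and> (\<forall>x\<in>set a. 1 \<le> x) \<and> (\<forall>i\<in>{1..n}. sort a ! (i - 1) \<le> i)}"

definition PFk :: "nat \<Rightarrow> nat \<Rightarrow> nat list set" where
  "PFk n k = {a \<in> PF n. k \<notin> set a \<and> (\<forall>j\<in>{k+1..n}. j \<in> set a)}"

text \<open>The points \<open>1, \<dots>, m\<close> are equally spaced, clockwise, on the unit circle of the complex plane.\<close>

definition circle_pt :: "nat \<Rightarrow> nat \<Rightarrow> complex" where
  "circle_pt m i = cis (- (2 * pi * real i / real m))"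

definition NC :: "nat \<Rightarrow> nat set set set" where
  "NC m = {\<sigma>. partition_on {1..m} \<sigma> \<and>
     pairwise (\<lambda>B C. disjnt (convex hull (circle_pt m ` B)) (convex hull (circle_pt m ` C))) \<sigma>}"

definition nc_less :: "nat \<Rightarrow> nat set set \<Rightarrow> nat set set \<Rightarrow> bool" where
  "nc_less m \<sigma> \<tau> \<longleftrightarrow> refines {1..m} \<sigma> \<tau> \<and> \<sigma> \<noteq> \<tau>"

text \<open>A maximal chain is represented by the list of its elements, from bottom to top.\<close>

definition nc_maxchains :: "nat \<Rightarrow> nat set set list set" where
  "nc_maxchains m =
     {c. sorted_wrt (nc_less m) c \<and> pred_on.maxchain (NC m) (nc_less m) (set c)}"

text \<open>\<open>B1\<close> and \<open>B2\<close> are the two blocks of \<open>\<sigma>\<close> that are merged in the covering relation \<open>\<sigma> < \<tau>\<close>.\<close>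

definition cover_label :: "nat set set \<Rightarrow> nat set set \<Rightarrow> nat" where
  "cover_label \<sigma> \<tau> = (THE i. \<exists>B1\<in>\<sigma>. \<exists>B2\<in>\<sigma>. B1 \<noteq> B2 \<and>
     \<tau> = insert (B1 \<union> B2) (\<sigma> - {B1, B2}) \<and>
     Min (B1 \<union> B2) \<in> B1 \<and>
     i = Max {j\<in>B1. \<forall>l\<in>B2. j < l})"

definition chain_labels :: "nat set set list \<Rightarrow> nat list" where
  "chain_labels c = map (\<lambda>i. cover_label (c ! i) (c ! Suc i)) [0..<length c - 1]"

definition chains_of :: "nat \<Rightarrow> nat list set \<Rightarrow> nat set set list set" where
  "chains_of n F = {c \<in> nc_maxchains (n + 1). chain_labels c \<in> F}"

definition Poset_elems :: "nat \<Rightarrow> nat list set \<Rightarrow> nat set set set" where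
  "Poset_elems n F = (\<Union>c\<in>chains_of n F. set c)"

definition Poset_covers :: "nat \<Rightarrow> nat list set \<Rightarrow> nat set set rel" where
  "Poset_covers n F = {(c ! i, c ! Suc i) | c i. c \<in> chains_of n F \<and> Suc i < length c}"

text \<open>
  The reflexive-transitive closure is taken over the whole type, hence the restriction to the
  elements (which only discards pairs \<open>(x, x)\<close> with \<open>x\<close> outside the poset).
\<close>

definition Poset_order :: "nat \<Rightarrow> nat list set \<Rightarrow> nat set set rel" where
  "Poset_order n F = Restr ((Poset_covers n F)\<^sup>*) (Poset_elems n F)"

text \<open>These are finite posets, so that \<open>mobius\<close> is specified on them.\<close>

lemma Poset_elems_subset: "Poset_elems n F \<subseteq> NC (n + 1)"
  unfolding Poset_elems_def chains_of_def nc_maxchains_def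
  by (auto simp: pred_on.maxchain_def pred_on.chain_def)

lemma finite_Poset_elems: "finite (Poset_elems n F)"
proof -
  have "NC (n + 1) \<subseteq> Pow (Pow {1..n + 1})"
    unfolding NC_def by (auto simp: partition_on_def)
  then show ?thesis
    using Poset_elems_subset by (meson finite_Pow_iff finite_atLeastAtMost finite_subset)
qed

lemma partial_order_Poset: "partial_order_on (Poset_elems n F) (Poset_order n F)"
proof -
  let ?E = "Poset_elems n F" and ?C = "Poset_covers n F"
  have less: "refines {1..n + 1} x y" if xy: "(x, y) \<in> ?C" for x y
  proof -
    obtain c i where c: "x = c ! i" "y = c ! Suc i" "Suc i < length c" "sorted_wrt (nc_less (n + 1)) c"
      using xy unfolding Poset_covers_def chains_of_def nc_maxchains_def by blast
    then have "nc_less (n + 1) x y"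
      using sorted_wrt_nth_less[of "nc_less (n + 1)" c i "Suc i"] by simp
    then show ?thesis
      by (simp add: nc_less_def)
  qed
  have "x = y \<or> refines {1..n + 1} x y" if "(x, y) \<in> ?C\<^sup>*" for x y
    using that
    by (induction rule: rtrancl_induct) (use less refines_trans in blast)+
  then have "antisym (?C\<^sup>*)"
    by (intro antisymI) (metis refines_asym)
  then have "antisym (Poset_order n F)"
    unfolding Poset_order_def by (rule antisym_subset[rotated]) auto
  moreover have "refl_on ?E (Poset_order n F)"
    unfolding Poset_order_def by (auto simp: refl_on_def)
  moreover have "trans (Poset_order n F)"
    unfolding Poset_order_def by (rule trans_Restr) (rule trans_rtrancl)
  ultimately show ?thesis
    unfolding partial_order_on_def preorder_on_def by (auto simp: Poset_order_def)
qed

end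

theory Submission
  imports Defs
begin

text \<open>
  Along a maximal chain every \<open>j > 1\<close> stops being the minimum of its block exactly once, with a label
  smaller than \<open>j\<close>. By counting, the labels lie in \<open>PF\<^bsub>n,k\<^esub>\<close> iff each \<open>j > k + 1\<close> is absorbed with
  label \<open>j - 1\<close> and \<open>k + 1\<close> is absorbed by a block not containing \<open>k\<close>. So the order is reachability by
  covers of this kind (\<open>good_cover\<close>).

  By induction, \<open>\<mu>(0, c) = 0\<close> for every \<open>c\<close> having \<open>k\<close> and \<open>k + 1\<close> in a common block \<open>D\<close>. On \<open>[0, c]\<close>
  consider the closure that joins the blocks of \<open>Min D\<close> and \<open>k + 1\<close>. It moves \<open>0\<close>, so by Rota's closure
  theorem the values \<open>\<mu>(0, x)\<close> over all \<open>x\<close> with closure \<open>c\<close> sum to \<open>0\<close>. All such \<open>x \<noteq> c\<close> again have \<open>k\<close>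
  and \<open>k + 1\<close> in a common block, because \<open>k + 1\<close> cannot be absorbed by the block of \<open>k\<close>. The case of the
  maximum \<open>c\<close> is the theorem.
\<close>

subsection \<open>Noncrossing partitions combinatorially\<close>

text \<open>Evenness and \<open>2 * pi\<close>-periodicity fold \<open>x\<close> into the interval
  from \<open>0\<close> to \<open>pi\<close>, where cosine strictly decreases.\<close>

lemma cos_less_cos_of_gap:
  fixes x w :: real
  assumes "0 \<le> w" "w < \<bar>x\<bar>" "\<bar>x\<bar> < 2 * pi - w"
  shows "cos x < cos w"
proof (cases "\<bar>x\<bar> \<le> pi")
  case True
  then have "cos \<bar>x\<bar> < cos w"
    using assms by (intro cos_monotone_0_pi) auto
  then show ?thesis
    by simp
next
  case False
  then have "cos (2 * pi - \<bar>x\<bar>) < cos w"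
    using assms by (intro cos_monotone_0_pi) auto
  moreover have "cos (2 * pi - \<bar>x\<bar>) = cos x"
    by (simp add: cos_diff)
  ultimately show ?thesis
    by simp
qed

lemma inner_cis: "cis a \<bullet> cis b = cos (a - b)"
  by (simp add: inner_complex_def cos_diff)

text \<open>The inner product of a circle point with the direction of the midpoint of the arc from
  \<open>u\<close> to \<open>v\<close> is the cosine of their angular distance. It is at least
  \<open>cos w\<close> on the arc and smaller elsewhere, so a line separates the two hulls.\<close>

lemma disjnt_hulls_of_interval:
  assumes uv: "u \<le> v" "v \<le> m" "1 \<le> u"
    and C: "C \<subseteq> {u..v}" and B: "B \<subseteq> {1..m} - {u..v}"
  shows "disjnt (convex hull (circle_pt m ` C)) (convex hull (circle_pt m ` B))"
proof -
  \<comment> \<open>\<open>\<phi>\<close> is the clockwise angle of the midpoint of the arc,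
    \<open>w\<close> half of its angular width.\<close>
  define \<phi> where "\<phi> = pi * (real u + real v) / m"
  define w where "w = pi * (real v - real u) / m"
  have m: "0 < real m"
    using uv by simp
  have inner: "cis (- \<phi>) \<bullet> circle_pt m j = cos (2 * pi * real j / m - \<phi>)" for j
    unfolding circle_pt_def inner_cis by (simp add: algebra_simps)
  have w0: "0 \<le> w"
    using uv m by (simp add: w_def)
  have "convex hull (circle_pt m ` C) \<subseteq> {z. cis (- \<phi>) \<bullet> z \<ge> cos w}"
  proof (rule hull_minimal)
    show "circle_pt m ` C \<subseteq> {z. cos w \<le> cis (- \<phi>) \<bullet> z}"
    proof (clarsimp simp: inner)
      fix j assume "j \<in> C"
      then have j: "u \<le> j" "j \<le> v"
        using C by auto
      have "\<bar>pi * (2 * real j - (real u + real v))\<bar> \<le> pi * (real v - real u)"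
        unfolding abs_mult using j by (intro mult_mono) auto
      then have "\<bar>2 * pi * real j / m - \<phi>\<bar> \<le> w"
        using m by (simp add: \<phi>_def w_def field_simps flip: diff_divide_distrib)
      moreover have "pi * (real v - real u) \<le> pi * real m"
        using uv by (intro mult_left_mono) auto
      then have "w \<le> pi"
        using m by (simp add: w_def field_simps)
      ultimately have "cos w \<le> cos \<bar>2 * pi * real j / m - \<phi>\<bar>"
        by (intro cos_monotone_0_pi_le) auto
      then show "cos w \<le> cos (2 * pi * real j / m - \<phi>)"
        by simp
    qed
  qed (rule convex_halfspace_ge)
  moreover have "convex hull (circle_pt m ` B) \<subseteq> {z. cis (- \<phi>) \<bullet> z < cos w}"
  proof (rule hull_minimal)
    show "circle_pt m ` B \<subseteq> {z. cis (- \<phi>) \<bullet> z < cos w}"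
    proof (clarsimp simp: inner)
      fix j assume "j \<in> B"
      then have j: "1 \<le> j" "j \<le> m" "j < u \<or> v < j"
        using B by auto
      have eq: "2 * pi * real j / m - \<phi> = pi * (2 * real j - (real u + real v)) / m"
        by (simp add: \<phi>_def field_simps flip: diff_divide_distrib)
      have "pi * (real v - real u) < \<bar>pi * (2 * real j - (real u + real v))\<bar>"
        unfolding abs_mult using j uv by (auto intro!: mult_strict_left_mono)
      then have "w < \<bar>2 * pi * real j / m - \<phi>\<bar>"
        unfolding eq w_def using m by (simp add: divide_strict_right_mono)
      moreover have "\<bar>pi * (2 * real j - (real u + real v))\<bar> < pi * (2 * real m - (real v - real u))"
        unfolding abs_mult using j uv by (auto intro!: mult_strict_left_mono)
      then have "\<bar>2 * pi * real j / m - \<phi>\<bar> < pi * (2 * real m - (real v - real u)) / m"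
        unfolding eq using m by (simp add: divide_strict_right_mono)
      moreover have "pi * (2 * real m - (real v - real u)) / m = 2 * pi - w"
        using m by (simp add: w_def field_simps)
      ultimately show "cos (2 * pi * real j / m - \<phi>) < cos w"
        using w0 by (intro cos_less_cos_of_gap) auto
    qed
  qed (rule convex_halfspace_lt)
  ultimately show ?thesis
    by (fastforce simp: disjnt_iff)
qed

section \<open>Crossing chords meet\<close>

text \<open>Twice the signed area of the triangle \<open>PQR\<close>, negative for vertices in
  clockwise order.\<close>

definition orient :: "complex \<Rightarrow> complex \<Rightarrow> complex \<Rightarrow> real" where
  "orient P Q R = (Re Q - Re P) * (Im R - Im P) - (Im Q - Im P) * (Re R - Re P)"

text \<open>The product form reveals the sign of the area of an inscribed triangle, as all three
  half-angles then lie strictly between \<open>0\<close> and \<open>pi\<close>.\<close>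

lemma sin_triangle:
  "sin x + sin y - sin (x + y) = 4 * sin (x / 2) * sin (y / 2) * sin ((x + y) / 2)" for x y :: real
proof -
  define u v where "u = x / 2" and "v = y / 2"
  have xy: "x = 2 * u" "y = 2 * v" "x / 2 = u" "y / 2 = v" "(x + y) / 2 = u + v"
    by (simp_all add: u_def v_def)
  have s: "sin (2 * u + 2 * v) = sin (2 * u) * cos (2 * v) + cos (2 * u) * sin (2 * v)"
    by (simp add: sin_add)
  have c: "cos (2 * v) = 1 - 2 * (sin v)\<^sup>2" "cos (2 * u) = 1 - 2 * (sin u)\<^sup>2"
    by (rule cos_double_sin)+
  show ?thesis
    unfolding xy(3-5) unfolding xy(1,2) s c sin_add[of u v] sin_double[of u] sin_double[of v]
    by (simp add: power2_eq_square algebra_simps)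
qed

lemma orient_cis:
  assumes "a < b" "b < c" "c < a + 2 * pi"
  shows "orient (cis (- a)) (cis (- b)) (cis (- c)) < 0"
proof -
  have "orient (cis (- a)) (cis (- b)) (cis (- c)) = - (sin (b - a) + sin (c - b) - sin (c - a))"
    by (simp add: orient_def sin_diff algebra_simps)
  also have "\<dots> = - (4 * sin ((b - a) / 2) * sin ((c - b) / 2) * sin ((c - a) / 2))"
    using sin_triangle[of "b - a" "c - b"] by simp
  also have "\<dots> < 0"
    using assms by (auto intro!: mult_pos_pos sin_gt_zero)
  finally show ?thesis .
qed

text \<open>
  The identity \<open>[BCD] A + [ABD] C = [ACD] B + [ABC] D\<close> between signed areas exhibits a common
  point of the two diagonals of a convex quadrilateral \<open>ABCD\<close>.
\<close>

lemma diagonals_meet: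
  assumes "orient B C D < 0" "orient A B D < 0" "orient A C D < 0" "orient A B C < 0"
  shows "\<exists>p. p \<in> convex hull {A, C} \<and> p \<in> convex hull {B, D}"
proof -
  define s where "s = orient B C D + orient A B D"
  have s': "s = orient A C D + orient A B C"
    by (simp add: s_def orient_def algebra_simps)
  have s0: "s < 0"
    using assms by (simp add: s_def)
  define p where "p = (orient B C D / s) *\<^sub>R A + (orient A B D / s) *\<^sub>R C"
  have "orient B C D * Re A + orient A B D * Re C = orient A C D * Re B + orient A B C * Re D"
    "orient B C D * Im A + orient A B D * Im C = orient A C D * Im B + orient A B C * Im D"
    by (simp_all add: orient_def algebra_simps)
  then have p': "p = (orient A C D / s) *\<^sub>R B + (orient A B C / s) *\<^sub>R D"
    using s0 by (simp add: p_def complex_eq_iff field_simps)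
  have hull: "u *\<^sub>R x + v *\<^sub>R y \<in> convex hull {x, y}" if "0 \<le> u" "0 \<le> v" "u + v = 1"
    for u v :: real and x y :: complex
    using that unfolding convex_hull_2 by blast
  have "p \<in> convex hull {A, C}"
    unfolding p_def using assms s0
    by (intro hull) (auto simp: divide_nonpos_neg s_def simp flip: add_divide_distrib)
  moreover have "p \<in> convex hull {B, D}"
    unfolding p' using assms s0
    by (intro hull) (auto simp: divide_nonpos_neg s' simp flip: add_divide_distrib)
  ultimately show ?thesis
    by blast
qed

section \<open>Geometric and combinatorial noncrossing agree\<close>

definition noncrossing :: "nat set set \<Rightarrow> bool" where
  "noncrossing \<sigma> \<longleftrightarrow> (\<forall>B\<in>\<sigma>. \<forall>C\<in>\<sigma>. \<forall>a\<in>B. \<forall>b\<in>C. \<forall>c\<in>B. \<forall>d\<in>C. a < b \<longrightarrow> b < c \<longrightarrow> c < d \<longrightarrow> B = C)"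

lemma noncrossingD:
  "noncrossing \<sigma> \<Longrightarrow> B \<in> \<sigma> \<Longrightarrow> C \<in> \<sigma> \<Longrightarrow> a \<in> B \<Longrightarrow> b \<in> C \<Longrightarrow> c \<in> B \<Longrightarrow> d \<in> C \<Longrightarrow>
    a < b \<Longrightarrow> b < c \<Longrightarrow> c < d \<Longrightarrow> B = C"
  unfolding noncrossing_def by blast

text \<open>The points \<open>a\<close>, \<open>b\<close>, \<open>c\<close>, \<open>d\<close> are
  the corners of a convex quadrilateral in clockwise order; one diagonal lies in the hull of
  \<open>B\<close>, the other in that of \<open>C\<close>.\<close>

lemma crossing_hulls_meet:
  assumes "a \<in> B" "b \<in> C" "c \<in> B" "d \<in> C" "a < b" "b < c" "c < d" "1 \<le> a" "d \<le> m"
  shows "\<not> disjnt (convex hull (circle_pt m ` B)) (convex hull (circle_pt m ` C))"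
proof -
  have m: "0 < real m"
    using assms by simp
  have "orient (circle_pt m i) (circle_pt m j) (circle_pt m l) < 0"
    if "i < j" "j < l" "1 \<le> i" "l \<le> m" for i j l
    unfolding circle_pt_def
  proof (rule orient_cis)
    show "2 * pi * real i / real m < 2 * pi * real j / real m"
      "2 * pi * real j / real m < 2 * pi * real l / real m"
      using that m by (simp_all add: divide_strict_right_mono)
    have "pi * real l < pi * (real i + real m)"
      using that by (intro mult_strict_left_mono) auto
    then show "2 * pi * real l / real m < 2 * pi * real i / real m + 2 * pi"
      using m by (simp add: field_simps)
  qed
  then have "\<exists>p. p \<in> convex hull {circle_pt m a, circle_pt m c} \<and> p \<in> convex hull {circle_pt m b, circle_pt m d}"
    using assms by (intro diagonals_meet) auto
  moreover have "convex hull {circle_pt m a, circle_pt m c} \<subseteq> convex hull (circle_pt m ` B)"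
    "convex hull {circle_pt m b, circle_pt m d} \<subseteq> convex hull (circle_pt m ` C)"
    using assms by (auto intro!: hull_mono)
  ultimately show ?thesis
    by (auto simp: disjnt_iff)
qed

text \<open>Hulls of crossing blocks meet. Conversely, of two noncrossing blocks either
  \<open>B\<close> avoids the interval spanned by \<open>C\<close>, or \<open>B\<close> sits in a
  gap of \<open>C\<close> and \<open>C\<close> avoids the interval spanned by \<open>B\<close>; in
  both cases an interval separates them.\<close>

lemma NC_iff: "\<sigma> \<in> NC m \<longleftrightarrow> partition_on {1..m} \<sigma> \<and> noncrossing \<sigma>"
proof
  assume L: "\<sigma> \<in> NC m"
  then have p: "partition_on {1..m} \<sigma>"
    and d: "pairwise (\<lambda>B C. disjnt (convex hull (circle_pt m ` B)) (convex hull (circle_pt m ` C))) \<sigma>"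
    by (auto simp: NC_def)
  have "noncrossing \<sigma>"
    unfolding noncrossing_def
  proof (intro ballI impI, rule ccontr)
    fix B C a b c d
    assume *: "B \<in> \<sigma>" "C \<in> \<sigma>" "a \<in> B" "b \<in> C" "c \<in> B" "d \<in> C" "a < b" "b < c" "c < d" "B \<noteq> C"
    then have "1 \<le> a" "d \<le> m"
      using partition_onD1[OF p] by auto
    then show False
      using crossing_hulls_meet[of a B b C c d m] * d by (auto simp: pairwise_def)
  qed
  with p show "partition_on {1..m} \<sigma> \<and> noncrossing \<sigma>" ..
next
  assume R: "partition_on {1..m} \<sigma> \<and> noncrossing \<sigma>"
  then have p: "partition_on {1..m} \<sigma>" and nc: "noncrossing \<sigma>"
    by auto
  have "disjnt (convex hull (circle_pt m ` B)) (convex hull (circle_pt m ` C))"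
    if BC: "B \<in> \<sigma>" "C \<in> \<sigma>" "B \<noteq> C" for B C
  proof -
    have sub: "B \<subseteq> {1..m}" "C \<subseteq> {1..m}" and ne: "B \<noteq> {}" "C \<noteq> {}" and dis: "B \<inter> C = {}"
      using p BC by (auto simp: partition_on_def pairwise_def disjnt_def)
    have fin: "finite B" "finite C"
      using sub by (auto intro: finite_subset)
    show ?thesis
    proof (cases "B \<inter> {Min C..Max C} = {}")
      case True
      then show ?thesis
        using sub ne fin by (subst disjnt_sym, intro disjnt_hulls_of_interval[of "Min C" "Max C"]) auto
    next
      case False
      then obtain b where b: "b \<in> B" "Min C \<le> b" "b \<le> Max C"
        by auto
      have C: "Min C \<in> C" "Max C \<in> C"
        using fin ne by auto
      have b': "Min C < b" "b < Max C"
        using b C dis by (auto simp: order.strict_iff_order)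
      have "Min B \<in> B" "Max B \<in> B"
        using fin ne by auto
      \<comment> \<open>Since \<open>b\<close> lies between \<open>Min C\<close> and
        \<open>Max C\<close>, a point of \<open>B\<close> outside this range would create a
        crossing.\<close>
      have inside: "Min C < b'" "b' < Max C" if "b' \<in> B" for b'
        using noncrossingD[OF nc BC(2,1) C(1) b(1) C(2) that b']
          noncrossingD[OF nc BC(1,2) that C(1) b(1) C(2) _ b'] that BC C dis
        by (metis disjoint_iff linorder_neqE_nat)+
      \<comment> \<open>An element \<open>c\<close> of the intersection would give the crossing
        \<open>Min C < Min B < c < Max B\<close>.\<close>
      have "C \<inter> {Min B..Max B} = {}"
      proof (rule ccontr)
        assume "C \<inter> {Min B..Max B} \<noteq> {}"
        then obtain c where c: "c \<in> C" "Min B \<le> c" "c \<le> Max B"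
          by auto
        then have "Min B < c" "c < Max B"
          using \<open>Min B \<in> B\<close> \<open>Max B \<in> B\<close> dis by (auto simp: order.strict_iff_order)
        then show False
          using noncrossingD[OF nc BC(2,1) C(1) \<open>Min B \<in> B\<close> c(1) \<open>Max B \<in> B\<close>] inside \<open>Min B \<in> B\<close> BC by auto
      qed
      then show ?thesis
        using sub ne fin by (intro disjnt_hulls_of_interval[of "Min B" "Max B"]) auto
    qed
  qed
  with p show "\<sigma> \<in> NC m"
    by (auto simp: NC_def pairwise_def)
qed

subsection \<open>Closures and the Moebius function\<close>

lemma sum_mobius_eq_0:
  assumes "finite A" "partial_order_on A r" "(z, y) \<in> r" "z \<noteq> y"
  shows "(\<Sum>x | (z, x) \<in> r \<and> (x, y) \<in> r. mobius A r z x) = 0"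
proof -
  have r: "r \<subseteq> A \<times> A" "refl_on A r"
    using assms(2) by (auto simp: partial_order_on_def preorder_on_def)
  then have y: "(y, y) \<in> r"
    using assms(3) by (auto simp: refl_on_def)
  have fin: "finite {x. (z, x) \<in> r \<and> (x, y) \<in> r}"
    using assms(1) r(1) by (auto intro: finite_subset[of _ A])
  have "{x. (z, x) \<in> r \<and> (x, y) \<in> r} - {y} = {x. (z, x) \<in> r \<and> (x, y) \<in> r \<and> x \<noteq> y}"
    by auto
  then show ?thesis
    using sum.remove[OF fin, of y "mobius A r z"] assms y mobius.simps[of A r z y] by simp
qed

text \<open>
  Rota's closure theorem for the closure \<open>f\<close> with closed elements \<open>U\<close>: as \<open>x \<le> y\<close> is equivalent to
  \<open>f x \<le> y\<close> for closed \<open>y\<close>, the fibre sums satisfy a triangular homogeneous linear system.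
\<close>

lemma sum_mobius_closure_fibre:
  assumes A: "finite A" "partial_order_on A r"
    and z: "\<And>x. x \<in> A \<Longrightarrow> (z, x) \<in> r" "z \<notin> U"
    and f: "\<And>x. (x, c) \<in> r \<Longrightarrow> (x, f x) \<in> r \<and> f x \<in> U"
    and least: "\<And>x y. (x, y) \<in> r \<Longrightarrow> (y, c) \<in> r \<Longrightarrow> y \<in> U \<Longrightarrow> (f x, y) \<in> r"
    and c: "c \<in> U" "c \<in> A"
  shows "(\<Sum>x | (x, c) \<in> r \<and> f x = c. mobius A r z x) = 0"
proof -
  have r: "r \<subseteq> A \<times> A" "refl_on A r" "trans r" "antisym r"
    using A(2) by (auto simp: partial_order_on_def preorder_on_def)
  have fin: "finite {x. (x, y) \<in> r}" for y
    using A(1) r(1) by (auto intro: finite_subset[of _ A])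
  have "(\<Sum>x | (x, c) \<in> r \<and> f x = y. mobius A r z x) = 0" if "y \<in> U" "(y, c) \<in> r" for y
    using that
  proof (induction "card {x. (x, y) \<in> r}" arbitrary: y rule: less_induct)
    case less
    let ?D = "{x. (x, y) \<in> r}" and ?V = "{u \<in> U. (u, y) \<in> r}"
    have y: "y \<in> A" "(y, y) \<in> r"
      using less.prems r(1,2) by (auto simp: refl_on_def)
    have finV: "finite ?V"
      by (rule finite_subset[OF _ fin[of y]]) auto
    have D: "?D = {x. (z, x) \<in> r \<and> (x, y) \<in> r}"
      using z(1) r(1) by auto
    have fV: "f ` ?D \<subseteq> ?V"
      using f least less.prems r(3) by (auto dest: transD)
    \<comment> \<open>Restricting to \<open>?D\<close> loses nothing: \<open>x\<close> lies below
      \<open>f x = u\<close>, and \<open>u\<close> below \<open>y\<close>.\<close>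
    have fibre: "{x. x \<in> ?D \<and> f x = u} = {x. (x, c) \<in> r \<and> f x = u}" if "u \<in> ?V" for u
      using that less.prems f r(3) by (auto dest: transD)
    have IH: "(\<Sum>x | (x, c) \<in> r \<and> f x = u. mobius A r z x) = 0" if u: "u \<in> ?V - {y}" for u
    proof (rule less.hyps)
      have "{x. (x, u) \<in> r} \<subseteq> ?D"
        using u r(3) by (auto dest: transD)
      moreover have "(y, u) \<notin> r"
        using u r(4) by (auto dest: antisymD)
      ultimately show "card {x. (x, u) \<in> r} < card ?D"
        using y fin by (intro psubset_card_mono) auto
      show "u \<in> U" "(u, c) \<in> r"
        using u less.prems r(3) by (auto dest: transD)
    qed
    \<comment> \<open>\<open>z\<close> is not closed, so \<open>z \<noteq> y\<close> and the values
      between \<open>z\<close> and \<open>y\<close> sum to \<open>0\<close>. Grouped by closure, all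
      fibres but that of \<open>y\<close> vanish by induction.\<close>
    have "0 = (\<Sum>x\<in>?D. mobius A r z x)"
      unfolding D using sum_mobius_eq_0[OF A] z less.prems y by auto
    also have "\<dots> = (\<Sum>u\<in>?V. \<Sum>x | x \<in> ?D \<and> f x = u. mobius A r z x)"
      by (rule sum.group[symmetric, OF fin finV fV])
    also have "\<dots> = (\<Sum>u\<in>?V. \<Sum>x | (x, c) \<in> r \<and> f x = u. mobius A r z x)"
      by (intro sum.cong refl) (simp only: fibre)
    also have "\<dots> = (\<Sum>x | (x, c) \<in> r \<and> f x = y. mobius A r z x)"
      using less.prems y sum.remove[OF finV, of y "\<lambda>u. \<Sum>x | (x, c) \<in> r \<and> f x = u. mobius A r z x"] IH
      by simp
    finally show ?case ..
  qed
  from this[OF c(1)] show ?thesis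
    using c r(2) by (auto simp: refl_on_def)
qed

subsection \<open>Merging blocks\<close>

lemma NC_block:
  assumes "\<sigma> \<in> NC m" "B \<in> \<sigma>"
  shows "B \<subseteq> {1..m}" "finite B" "B \<noteq> {}" "Min B \<in> B"
proof -
  show 1: "B \<subseteq> {1..m}" and 2: "B \<noteq> {}"
    using assms by (auto simp: NC_iff partition_on_def)
  show "finite B"
    using 1 by (rule finite_subset) simp
  with 2 show "Min B \<in> B"
    by simp
qed

lemma NC_block_unique: "\<sigma> \<in> NC m \<Longrightarrow> B \<in> \<sigma> \<Longrightarrow> C \<in> \<sigma> \<Longrightarrow> x \<in> B \<Longrightarrow> x \<in> C \<Longrightarrow> B = C"
  by (auto simp: NC_iff partition_on_def pairwise_def disjnt_iff)

lemma NC_block_ex: "\<sigma> \<in> NC m \<Longrightarrow> x \<in> {1..m} \<Longrightarrow> \<exists>B\<in>\<sigma>. x \<in> B"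
  by (auto simp: NC_iff partition_on_def)

lemma NC_noncrossing: "\<sigma> \<in> NC m \<Longrightarrow> noncrossing \<sigma>"
  by (simp add: NC_iff)

lemma finite_NC_elem: "\<sigma> \<in> NC m \<Longrightarrow> finite \<sigma>"
  by (auto simp: NC_iff intro: finite_elements)

lemma refines_block_subset:
  assumes "refines {1..m} \<sigma> \<tau>" "\<tau> \<in> NC m" "B \<in> \<sigma>" "D \<in> \<tau>" "x \<in> B" "x \<in> D"
  shows "B \<subseteq> D"
proof -
  obtain Y where "Y \<in> \<tau>" "B \<subseteq> Y"
    using assms(1,3) by (auto simp: refines_def)
  moreover have "Y = D"
    using assms calculation by (intro NC_block_unique[of \<tau> m]) auto
  ultimately show ?thesis
    by simp
qed

lemma Min_le_in: "\<sigma> \<in> NC m \<Longrightarrow> B \<in> \<sigma> \<Longrightarrow> x \<in> B \<Longrightarrow> Min B \<le> x"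
  by (rule Min_le) (auto dest: NC_block)

text \<open>\<open>B\<close> is the block \<open>B1\<close> of the labelling rule, and
  \<open>Min C\<close> is the element that ceases to be a block minimum.\<close>

definition merges :: "nat \<Rightarrow> nat set set \<Rightarrow> nat set set \<Rightarrow> nat set \<Rightarrow> nat set \<Rightarrow> bool" where
  "merges m \<sigma> \<tau> B C \<longleftrightarrow> \<sigma> \<in> NC m \<and> \<tau> \<in> NC m \<and> B \<in> \<sigma> \<and> C \<in> \<sigma> \<and> Min B < Min C \<and>
    \<tau> = insert (B \<union> C) (\<sigma> - {B, C})"

lemma mergesD:
  assumes "merges m \<sigma> \<tau> B C"
  shows "\<sigma> \<in> NC m" "\<tau> \<in> NC m" "B \<in> \<sigma>" "C \<in> \<sigma>" "Min B < Min C" "\<tau> = insert (B \<union> C) (\<sigma> - {B, C})"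
    "B \<noteq> C" "B \<inter> C = {}" "B \<union> C \<notin> \<sigma>" "B \<union> C \<in> \<tau>" "Min (B \<union> C) = Min B" "finite B" "finite C"
proof -
  show *: "\<sigma> \<in> NC m" "\<tau> \<in> NC m" "B \<in> \<sigma>" "C \<in> \<sigma>" "Min B < Min C" "\<tau> = insert (B \<union> C) (\<sigma> - {B, C})"
    using assms by (auto simp: merges_def)
  show "B \<noteq> C"
    using *(5) by auto
  then show 1: "B \<inter> C = {}"
    using NC_block_unique[OF *(1,3,4)] by auto
  have ne: "B \<noteq> {}" "C \<noteq> {}"
    using NC_block(3)[OF *(1)] *(3,4) by auto
  then obtain x y where "x \<in> B" "y \<in> C"
    by auto
  then show "B \<union> C \<notin> \<sigma>"
    using NC_block_unique[OF *(1,3), of "B \<union> C" x] NC_block_unique[OF *(1,4), of "B \<union> C" y] \<open>B \<noteq> C\<close>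
    by auto
  show "B \<union> C \<in> \<tau>"
    using * by auto
  show "finite B" "finite C"
    using NC_block(2)[OF *(1)] *(3,4) by auto
  then show "Min (B \<union> C) = Min B"
    using ne *(5) by (simp add: Min_Un)
qed

lemma partition_on_merge:
  assumes p: "partition_on A \<sigma>" and BC: "B \<in> \<sigma>" "C \<in> \<sigma>"
  shows "partition_on A (insert (B \<union> C) (\<sigma> - {B, C}))"
proof (rule partition_onI)
  show "\<Union> (insert (B \<union> C) (\<sigma> - {B, C})) = A"
    using partition_onD1[OF p] BC by auto
  show "{} \<notin> insert (B \<union> C) (\<sigma> - {B, C})"
    using partition_onD3[OF p] BC by auto
  have d: "disjnt X Y" if "X \<in> \<sigma>" "Y \<in> \<sigma>" "X \<noteq> Y" for X Y
    using partition_onD2[OF p] that by (auto simp: pairwise_def)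
  have new: "disjnt (B \<union> C) Y" if "Y \<in> \<sigma> - {B, C}" for Y
    using that d[OF BC(1), of Y] d[OF BC(2), of Y] by (auto simp: disjnt_Un1)
  fix X Y
  assume XY: "X \<in> insert (B \<union> C) (\<sigma> - {B, C})" "Y \<in> insert (B \<union> C) (\<sigma> - {B, C})" "X \<noteq> Y"
  then consider "X = B \<union> C" "Y \<in> \<sigma> - {B, C}" | "Y = B \<union> C" "X \<in> \<sigma> - {B, C}" | "X \<in> \<sigma>" "Y \<in> \<sigma>"
    by (metis DiffD1 insert_iff)
  then show "disjnt X Y"
  proof cases
    case 1
    then show ?thesis using new[of Y] by simp
  next
    case 2
    then show ?thesis using new[of X] by (simp add: disjnt_sym)
  next
    case 3
    then show ?thesis using d XY(3) by simp
  qed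
qed

lemma merges_refines:
  assumes "merges m \<sigma> \<tau> B C"
  shows "refines {1..m} \<sigma> \<tau>"
proof -
  note * = mergesD[OF assms]
  have "\<exists>Y\<in>\<tau>. X \<subseteq> Y" if "X \<in> \<sigma>" for X
    using that *(6) by (cases "X \<in> {B, C}") auto
  then show ?thesis
    using *(1,2) by (simp add: refines_def NC_iff)
qed

lemma card_merges:
  assumes "merges m \<sigma> \<tau> B C"
  shows "card \<sigma> = Suc (card \<tau>)"
proof -
  note * = mergesD[OF assms]
  have fin: "finite \<sigma>"
    using * finite_NC_elem by blast
  then have "card (\<sigma> - {B, C}) = card \<sigma> - 2"
    using * by (subst card_Diff_subset) auto
  moreover have "card {B, C} \<le> card \<sigma>"
    using * fin by (intro card_mono) auto
  ultimately show ?thesis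
    using * fin by simp
qed

section \<open>Merges between comparable noncrossing partitions\<close>

text \<open>Noncrossingness of \<open>\<tau>\<close> keeps blocks outside \<open>D\<close> from
  crossing \<open>B \<union> C\<close>, and that of \<open>\<sigma>\<close> excludes crossings whose
  two merged points lie in the same block. What is left to \<open>H\<close> are blocks
  \<open>G\<close> inside \<open>D\<close> against one point of \<open>B\<close> and one of
  \<open>C\<close>.\<close>

lemma merge_in_NC:
  assumes NC: "\<sigma> \<in> NC m" "\<tau> \<in> NC m" and ref: "refines {1..m} \<sigma> \<tau>"
    and BC: "B \<in> \<sigma>" "C \<in> \<sigma>" and D: "D \<in> \<tau>" "B \<subseteq> D" "C \<subseteq> D"
    and H: "\<And>G a b c d. G \<in> \<sigma> \<Longrightarrow> G \<noteq> B \<Longrightarrow> G \<noteq> C \<Longrightarrow> G \<subseteq> D \<Longrightarrow>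
      a \<in> B \<Longrightarrow> c \<in> C \<Longrightarrow> b \<in> G \<Longrightarrow> d \<in> G \<Longrightarrow>
      \<not> (a < b \<and> b < c \<and> c < d) \<and> \<not> (c < b \<and> b < a \<and> a < d) \<and>
      \<not> (b < a \<and> a < d \<and> d < c) \<and> \<not> (b < c \<and> c < d \<and> d < a)"
  shows "insert (B \<union> C) (\<sigma> - {B, C}) \<in> NC m" (is "?\<rho> \<in> _")
    and "refines {1..m} (insert (B \<union> C) (\<sigma> - {B, C})) \<tau>"
proof -
  note nc = noncrossingD[OF NC_noncrossing[OF NC(1)]]
  have p: "partition_on {1..m} ?\<rho>"
    using NC BC by (intro partition_on_merge) (auto simp: NC_iff)
  have key: "\<not> (a < b \<and> b < c \<and> c < d) \<and> \<not> (b < a \<and> a < d \<and> d < c)"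
    if G: "G \<in> \<sigma>" "G \<noteq> B" "G \<noteq> C" "b \<in> G" "d \<in> G" and ac: "a \<in> B \<union> C" "c \<in> B \<union> C" for G a b c d
  proof (cases "G \<subseteq> D")
    case True
    then show ?thesis
      using H[OF G(1-3) True, of a c b d] H[OF G(1-3) True, of c a b d] G ac
        nc[of B G a b c d] nc[of C G a b c d] nc[of G B b a d c] nc[of G C b a d c] BC by blast
  next
    case False
    obtain D' where D': "D' \<in> \<tau>" "G \<subseteq> D'"
      using ref G by (auto simp: refines_def)
    with False have "D \<noteq> D'"
      by auto
    then show ?thesis
      using noncrossingD[OF NC_noncrossing[OF NC(2)] D(1) D'(1), of a b c d]
        noncrossingD[OF NC_noncrossing[OF NC(2)] D'(1) D(1), of b a d c] D D' G ac by blast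
  qed
  have "noncrossing ?\<rho>"
    unfolding noncrossing_def
  proof (intro ballI impI)
    fix X Y a b c d
    assume *: "X \<in> ?\<rho>" "Y \<in> ?\<rho>" "a \<in> X" "b \<in> Y" "c \<in> X" "d \<in> Y" "a < b" "b < c" "c < d"
    consider "X = B \<union> C" "Y = B \<union> C" | "X = B \<union> C" "Y \<in> \<sigma> - {B, C}"
      | "Y = B \<union> C" "X \<in> \<sigma> - {B, C}" | "X \<in> \<sigma>" "Y \<in> \<sigma>"
      using *(1,2) by blast
    then show "X = Y"
    proof cases
      case 2
      then show ?thesis using key[of Y b d a c] * by blast
    next
      case 3
      then show ?thesis using key[of X a c b d] * by blast
    next
      case 4
      then show ?thesis using nc[of X Y a b c d] * by blast
    qed simp
  qed
  with p show "?\<rho> \<in> NC m"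
    by (simp add: NC_iff)
  show "refines {1..m} ?\<rho> \<tau>"
    using p ref D unfolding refines_def by auto
qed

text \<open>In a block \<open>D\<close> that still has to be assembled, \<open>B\<close> is the
  block of \<open>Min D\<close> and \<open>C\<close> the block of the least element \<open>j\<close>
  outside \<open>B\<close>. All of \<open>D\<close> below \<open>Min C\<close> then lies in
  \<open>B\<close>, which later turns \<open>Min C - 1 \<in> D\<close> into
  \<open>Min C - 1 \<in> B\<close>.\<close>

lemma exists_merge:
  assumes NC: "\<sigma> \<in> NC m" "\<tau> \<in> NC m" and ref: "refines {1..m} \<sigma> \<tau>" and ne: "\<sigma> \<noteq> \<tau>"
  obtains \<rho> B C D where "merges m \<sigma> \<rho> B C" "refines {1..m} \<rho> \<tau>" "D \<in> \<tau>" "B \<subseteq> D" "C \<subseteq> D"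
    "\<And>i. i \<in> D \<Longrightarrow> i < Min C \<Longrightarrow> i \<in> B"
proof -
  note nc = noncrossingD[OF NC_noncrossing[OF NC(1)]]
  \<comment> \<open>A partition cannot be properly included in another partition of the same
    set.\<close>
  have "\<not> \<sigma> \<subseteq> \<tau>"
  proof
    assume sub: "\<sigma> \<subseteq> \<tau>"
    have "\<tau> \<subseteq> \<sigma>"
    proof
      fix Y assume Y: "Y \<in> \<tau>"
      have "Min Y \<in> {1..m}"
        using NC_block(1,4)[OF NC(2) Y] by (rule subsetD)
      then obtain X where "X \<in> \<sigma>" "Min Y \<in> X"
        using NC_block_ex[OF NC(1), of "Min Y"] by auto
      then show "Y \<in> \<sigma>"
        using NC_block_unique[OF NC(2), of X Y "Min Y"] NC_block(4)[OF NC(2) Y] sub Y by auto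
    qed
    with sub ne show False
      by auto
  qed
  then obtain X where X: "X \<in> \<sigma>" "X \<notin> \<tau>"
    by auto
  then obtain D where D: "D \<in> \<tau>" "X \<subseteq> D"
    using ref by (auto simp: refines_def)
  note D' = NC_block[OF NC(2) D(1)]
  define e where "e = Min D"
  have e: "e \<in> D" "\<And>x. x \<in> D \<Longrightarrow> e \<le> x"
    using D' by (auto simp: e_def)
  then obtain B where B: "B \<in> \<sigma>" "e \<in> B"
    using NC_block_ex[OF NC(1) subsetD[OF D'(1) e(1)]] by blast
  have BD: "B \<subseteq> D"
    using refines_block_subset[OF ref NC(2) B(1) D(1) B(2) e(1)] .
  have "B \<noteq> D"
    using NC_block_unique[OF NC(1) X(1) B(1)] NC_block(4)[OF NC(1) X(1)] X D B by auto
  then have neD: "D - B \<noteq> {}"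
    using BD by auto
  define j where "j = Min (D - B)"
  have "j \<in> D - B"
    unfolding j_def using D' neD by (intro Min_in) auto
  then have j: "j \<in> D" "j \<notin> B" and j_le: "\<And>x. x \<in> D \<Longrightarrow> x \<notin> B \<Longrightarrow> j \<le> x"
    using D' by (auto simp: j_def)
  then obtain C where C: "C \<in> \<sigma>" "j \<in> C"
    using NC_block_ex[OF NC(1) subsetD[OF D'(1) j(1)]] by blast
  have CD: "C \<subseteq> D"
    using refines_block_subset[OF ref NC(2) C(1) D(1) C(2) j(1)] .
  have "B \<noteq> C"
    using j C by auto
  have j_le': "j \<le> x" if "x \<in> G" "G \<in> \<sigma>" "G \<noteq> B" "G \<subseteq> D" for x G
    using that j_le[of x] NC_block_unique[OF NC(1) that(2) B(1) that(1)] by auto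
  have MinC: "Min C = j"
    using C j_le'[OF _ C(1) \<open>B \<noteq> C\<close>[symmetric] CD] NC_block[OF NC(1) C(1)] by (intro Min_eqI) auto
  have MinB: "Min B = e"
    using B e BD NC_block[OF NC(1) B(1)] by (intro Min_eqI) auto
  have ej: "e < j"
    using e(2)[OF j(1)] j(2) B(2) by (auto simp: order.strict_iff_order)
  \<comment> \<open>Each of the four patterns contains \<open>b < c < d\<close> or
    \<open>b < a < d\<close>. As \<open>G\<close> lies above \<open>j\<close> and \<open>e\<close>,
    prefixing \<open>j\<close> in the first case and \<open>e\<close> in the second gives a crossing
    in \<open>\<sigma>\<close>.\<close>
  have H: "\<not> (a < b \<and> b < c \<and> c < d) \<and> \<not> (c < b \<and> b < a \<and> a < d) \<and>
      \<not> (b < a \<and> a < d \<and> d < c) \<and> \<not> (b < c \<and> c < d \<and> d < a)"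
    if G: "G \<in> \<sigma>" "G \<noteq> B" "G \<noteq> C" "G \<subseteq> D" and x: "a \<in> B" "c \<in> C" "b \<in> G" "d \<in> G" for G a b c d
  proof -
    have "j \<noteq> b"
      using NC_block_unique[OF NC(1) C(1) G(1) C(2)] x G by auto
    then have "j < b"
      using j_le'[OF x(3) G(1,2,4)] by auto
    with ej have "e < b"
      by simp
    show ?thesis
      using nc[OF C(1) G(1) C(2) x(3) x(2) x(4) \<open>j < b\<close>] nc[OF B(1) G(1) B(2) x(3) x(1) x(4) \<open>e < b\<close>]
        G by auto
  qed
  note m = merge_in_NC[OF NC ref B(1) C(1) D(1) BD CD H]
  have "merges m \<sigma> (insert (B \<union> C) (\<sigma> - {B, C})) B C"
    unfolding merges_def using NC B C m(1) MinB MinC ej by simp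
  moreover have "i \<in> B" if "i \<in> D" "i < Min C" for i
    using that j_le[of i] MinC by (meson not_less)
  ultimately show ?thesis
    using that[OF _ m(2) D(1) BD CD] by simp
qed

section \<open>The least and the greatest noncrossing partition\<close>

definition bot_partition :: "nat \<Rightarrow> nat set set" where
  "bot_partition m = (\<lambda>x. {x}) ` {1..m}"

definition top_partition :: "nat \<Rightarrow> nat set set" where
  "top_partition m = {{1..m}}"

lemma bot_in_NC: "bot_partition m \<in> NC m"
  unfolding NC_iff bot_partition_def noncrossing_def by (auto simp: partition_on_singletons)

lemma top_in_NC: "1 \<le> m \<Longrightarrow> top_partition m \<in> NC m"
  unfolding NC_iff top_partition_def noncrossing_def by (auto intro!: partition_on_space)

lemma bot_refines: "\<sigma> \<in> NC m \<Longrightarrow> refines {1..m} (bot_partition m) \<sigma>"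
  unfolding refines_def using bot_in_NC[of m] NC_block_ex[of \<sigma> m]
  by (auto simp: NC_iff bot_partition_def)

lemma refines_top: "1 \<le> m \<Longrightarrow> \<sigma> \<in> NC m \<Longrightarrow> refines {1..m} \<sigma> (top_partition m)"
  unfolding refines_def using top_in_NC[of m] NC_block[of \<sigma> m]
  by (auto simp: NC_iff top_partition_def)

subsection \<open>Good covers\<close>

text \<open>For the label \<open>l\<close> of the cover, which is the largest element of
  \<open>B\<close> below \<open>Min C\<close>, the conclusions of the two conditions amount to
  \<open>l = Min C - 1\<close> and \<open>l \<noteq> k\<close> in the respective cases.\<close>

definition good_cover :: "nat \<Rightarrow> nat \<Rightarrow> nat set set rel" where
  "good_cover m k = {(\<sigma>, \<tau>). \<exists>B C. merges m \<sigma> \<tau> B C \<and>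
     (k + 1 < Min C \<longrightarrow> Min C - 1 \<in> B) \<and> (Min C = k + 1 \<longrightarrow> k \<notin> B)}"

lemma good_coverE:
  assumes "(\<sigma>, \<tau>) \<in> good_cover m k"
  obtains B C where "merges m \<sigma> \<tau> B C" "k + 1 < Min C \<Longrightarrow> Min C - 1 \<in> B" "Min C = k + 1 \<Longrightarrow> k \<notin> B"
  using assms unfolding good_cover_def by blast

lemma good_coverI:
  assumes "merges m \<sigma> \<tau> B C" "k + 1 < Min C \<Longrightarrow> Min C - 1 \<in> B" "Min C = k + 1 \<Longrightarrow> k \<notin> B"
  shows "(\<sigma>, \<tau>) \<in> good_cover m k"
  using assms unfolding good_cover_def by blast

lemma good_path_refines:
  assumes "(\<sigma>, \<tau>) \<in> (good_cover m k)\<^sup>*" "\<sigma> \<in> NC m"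
  shows "\<tau> \<in> NC m \<and> refines {1..m} \<sigma> \<tau>"
  using assms
proof (induction rule: rtrancl_induct)
  case base
  then show ?case by (auto simp: NC_iff intro: refines_refl)
next
  case (step y z)
  from step(2) obtain B C where BC: "merges m y z B C"
    by (rule good_coverE)
  have "refines {1..m} \<sigma> y"
    using step by simp
  then show ?case
    using mergesD(2)[OF BC] refines_trans[OF _ merges_refines[OF BC]] by simp
qed

section \<open>An invariant of good paths, and when good paths exist\<close>

text \<open>The elements of a block above \<open>k\<close> form an interval, which starts at
  \<open>k + 1\<close> if the block also has an element up to \<open>k\<close>.\<close>

definition tail_connected :: "nat \<Rightarrow> nat set set \<Rightarrow> bool" where
  "tail_connected k \<sigma> \<longleftrightarrow> (\<forall>B\<in>\<sigma>. \<forall>j\<in>B. k + 1 < j \<longrightarrow> j \<noteq> Min B \<longrightarrow> j - 1 \<in> B)"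

lemma tail_connectedD:
  "tail_connected k \<sigma> \<Longrightarrow> B \<in> \<sigma> \<Longrightarrow> j \<in> B \<Longrightarrow> k + 1 < j \<Longrightarrow> j \<noteq> Min B \<Longrightarrow> j - 1 \<in> B"
  unfolding tail_connected_def by blast

lemma tail_connected_interval:
  assumes "tail_connected k \<sigma>" "\<sigma> \<in> NC m" "B \<in> \<sigma>" "x \<in> B" "y \<in> B" "x \<le> z" "z \<le> y" "k + 1 \<le> z"
  shows "z \<in> B"
  using assms(7,5)
proof (induction rule: inc_induct)
  case (step i)
  then have "Suc i \<noteq> Min B"
    using Min_le_in[OF assms(2,3,4)] assms(6) by linarith
  then have "Suc i - 1 \<in> B"
    using step assms(8) by (intro tail_connectedD[OF assms(1,3)]) auto
  then show ?case
    by simp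
qed simp

text \<open>In a merged block only \<open>Min C\<close> newly fails to be the minimum, and goodness
  supplies its predecessor in \<open>B\<close>.\<close>

lemma good_path_tail_connected:
  assumes "(\<sigma>, \<tau>) \<in> (good_cover m k)\<^sup>*" "tail_connected k \<sigma>"
  shows "tail_connected k \<tau>"
  using assms
proof (induction rule: rtrancl_induct)
  case (step y z)
  from step(2) obtain B C where BC: "merges m y z B C" "k + 1 < Min C \<Longrightarrow> Min C - 1 \<in> B"
    by (elim good_coverE) blast
  note * = mergesD[OF BC(1)]
  have y: "tail_connected k y"
    using step by simp
  have new: "j - 1 \<in> B \<union> C" if "j \<in> B \<union> C" "k + 1 < j" "j \<noteq> Min B" for j
    using that tail_connectedD[OF y *(3), of j] tail_connectedD[OF y *(4), of j] BC(2) by auto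
  show ?case
    unfolding tail_connected_def
  proof (intro ballI impI)
    fix X j assume X: "X \<in> z" "j \<in> X" "k + 1 < j" "j \<noteq> Min X"
    show "j - 1 \<in> X"
    proof (cases "X = B \<union> C")
      case True
      then show ?thesis using new[of j] X *(11) by simp
    next
      case False
      then have "X \<in> y" using X *(6) by auto
      then show ?thesis using tail_connectedD[OF y _ X(2-4)] by simp
    qed
  qed
qed

lemma tail_connected_bot: "tail_connected k (bot_partition m)"
  by (auto simp: tail_connected_def bot_partition_def)

lemma tail_connected_top: "1 \<le> m \<Longrightarrow> tail_connected k (top_partition m)"
proof -
  assume "1 \<le> m"
  then have "Min {1..m} = 1" by (intro Min_eqI) auto
  then show ?thesis
    by (auto simp: tail_connected_def top_partition_def)
qed

text \<open>Once \<open>k + 1\<close> is not the minimum of its block, refinement is the only obstruction.\<close>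

lemma good_path_if_refines:
  assumes "\<sigma> \<in> NC m" "\<tau> \<in> NC m" "refines {1..m} \<sigma> \<tau>" "tail_connected k \<tau>"
    and "A \<in> \<sigma>" "k + 1 \<in> A" "Min A \<noteq> k + 1"
  shows "(\<sigma>, \<tau>) \<in> (good_cover m k)\<^sup>*"
  using assms
proof (induction "card \<sigma>" arbitrary: \<sigma> A rule: less_induct)
  case less
  show ?case
  proof (cases "\<sigma> = \<tau>")
    case False
    obtain \<rho> B C D where \<rho>: "merges m \<sigma> \<rho> B C" "refines {1..m} \<rho> \<tau>" "D \<in> \<tau>" "B \<subseteq> D" "C \<subseteq> D"
      "\<And>i. i \<in> D \<Longrightarrow> i < Min C \<Longrightarrow> i \<in> B"
      using exists_merge[OF less.prems(1-3) False] by metis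
    note * = mergesD[OF \<rho>(1)]
    have C: "Min C \<in> C"
      using *(1,4) by (rule NC_block)
    have "(\<sigma>, \<rho>) \<in> good_cover m k"
    proof (rule good_coverI[OF \<rho>(1)])
      assume k: "k + 1 < Min C"
      \<comment> \<open>\<open>Min C\<close> is therefore not the minimum of \<open>D\<close>, so
        tail connectedness of \<open>\<tau>\<close> puts \<open>Min C - 1\<close> into
        \<open>D\<close>, and the choice of the merge puts it into \<open>B\<close>.\<close>
      have "Min D \<le> Min B"
        using \<rho>(3,4) less.prems(2) NC_block(4)[OF *(1,3)] by (intro Min_le_in[of \<tau> m]) auto
      then have "Min C - 1 \<in> D"
        using tail_connectedD[OF less.prems(4) \<rho>(3), of "Min C"] \<rho>(5) C k *(5) by auto
      then show "Min C - 1 \<in> B"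
        using \<rho>(6) k by simp
    next
      assume "Min C = k + 1"
      \<comment> \<open>Contradictory case, since the minimum of \<open>A\<close> is not
        \<open>k + 1\<close>.\<close>
      then have "C = A"
        using NC_block_unique[OF less.prems(1) *(4) less.prems(5)] C less.prems by auto
      then show "k \<notin> B"
        using less.prems \<open>Min C = k + 1\<close> by simp
    qed
    \<comment> \<open>After the merge the minimum of the block of \<open>k + 1\<close> still differs
      from \<open>k + 1\<close>, so the induction hypothesis applies.\<close>
    moreover have "(\<rho>, \<tau>) \<in> (good_cover m k)\<^sup>*"
    proof (cases "A = B \<or> A = C")
      case True
      have "Min C \<le> k + 1" if "A = C"
        using Min_le_in[OF *(1,4)] less.prems that by blast
      with True less.prems *(5) have "Min (B \<union> C) \<noteq> k + 1"
        unfolding *(11) by auto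
      with True show ?thesis
        using \<rho>(2) * less.prems card_merges[OF \<rho>(1)]
        by (intro less.hyps[of \<rho> "B \<union> C"]) auto
    next
      case False
      then show ?thesis
        using \<rho>(2) * less.prems card_merges[OF \<rho>(1)]
        by (intro less.hyps[of \<rho> A]) auto
    qed
    ultimately show ?thesis
      by (rule converse_rtrancl_into_rtrancl)
  qed simp
qed

text \<open>Consider the step merging the block \<open>C\<close> of \<open>k + 1\<close> into a
  block \<open>B\<close> that contains \<open>F\<close>. If \<open>Min C = k + 1\<close>, goodness
  excludes \<open>k\<close> from \<open>B\<close>. Otherwise \<open>k \<in> B\<close> would give the
  crossing \<open>Min B < Min C < k < k + 1\<close>.\<close>

lemma good_path_obstruction:
  assumes "(\<sigma>, \<tau>) \<in> (good_cover m k)\<^sup>*" "\<sigma> \<in> NC m"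
    and "A \<in> \<sigma>" "k + 1 \<in> A" "Min A = k + 1"
    and "D \<in> \<tau>" "k + 1 \<in> D" "Min D \<noteq> k + 1"
    and "F \<in> \<sigma>" "Min D \<in> F"
  shows "k \<notin> F"
  using assms(1,6-)
proof (induction arbitrary: D rule: rtrancl_induct)
  case base
  then show ?case
    using NC_block_unique[OF assms(2) assms(3) _ assms(4)] assms(5) by auto
next
  case (step y z)
  from step(2) obtain B C where BC: "merges m y z B C" "Min C = k + 1 \<Longrightarrow> k \<notin> B"
    by (elim good_coverE) blast
  note * = mergesD[OF BC(1)]
  have ref: "refines {1..m} \<sigma> y"
    using good_path_refines[OF step(1) assms(2)] by simp
  show ?case
  proof (cases "D \<in> y")
    case True
    then show ?thesis using step by blast
  next
    case False
    then have D: "D = B \<union> C"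
      using step(4) *(6) by auto
    then have MinD: "Min D = Min B"
      using *(11) by simp
    show ?thesis
    proof (cases "k + 1 \<in> B")
      case True
      then show ?thesis
        using step.IH[OF *(3) True] step.prems MinD by simp
    next
      case False
      then have C: "k + 1 \<in> C"
        using D step.prems by auto
      have FB: "F \<subseteq> B"
        using refines_block_subset[OF ref *(1) step.prems(4) *(3) step.prems(5)] MinD NC_block(4)[OF *(1,3)]
        by simp
      show ?thesis
      proof (cases "Min C = k + 1")
        case True
        then show ?thesis
          using BC(2) FB by auto
      next
        case False
        show ?thesis
        proof
          assume "k \<in> F"
          then have kB: "k \<in> B"
            using FB by auto
          have C': "Min C \<in> C" "Min C \<le> k + 1" and B': "Min B \<in> B"
            using Min_le_in[OF *(1,4) C] NC_block(4)[OF *(1,4)] NC_block(4)[OF *(1,3)] by auto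
          have "Min C \<noteq> k"
            using *(8) kB C' by auto
          then have "Min C < k"
            using C'(2) False by simp
          then show False
            using noncrossingD[OF NC_noncrossing[OF *(1)] *(3,4) B' C'(1) kB C] *(5,7) by simp
        qed
      qed
    qed
  qed
qed

text \<open>
  \<open>y\<close> arises from \<open>x\<close> by joining the blocks of \<open>Min D\<close> and \<open>k + 1\<close>. Noncrossingness forces
  \<open>k\<close> and \<open>k + 1\<close> to be in the same block of \<open>x\<close> when \<open>y = c\<close>.
\<close>

lemma exists_least_join:
  assumes x: "(bot_partition m, x) \<in> (good_cover m k)\<^sup>*" "(x, c) \<in> (good_cover m k)\<^sup>*"
    and D: "D \<in> c" "k \<in> D" "k + 1 \<in> D"
  defines "U \<equiv> {y. \<exists>B\<in>y. Min D \<in> B \<and> k + 1 \<in> B}"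
  shows "\<exists>y\<in>U. (x, y) \<in> (good_cover m k)\<^sup>* \<and>
    (\<forall>w\<in>U. (x, w) \<in> (good_cover m k)\<^sup>* \<longrightarrow> (y, w) \<in> (good_cover m k)\<^sup>*) \<and>
    (y = c \<longrightarrow> x \<noteq> c \<longrightarrow> (\<exists>B\<in>x. k \<in> B \<and> k + 1 \<in> B))"
proof (cases "x \<in> U")
  case True
  \<comment> \<open>Here \<open>x\<close> itself is the least choice; the last clause is vacuous for
    \<open>y = x\<close>.\<close>
  then show ?thesis by blast
next
  case False
  define e where "e = Min D"
  have xNC: "x \<in> NC m"
    using good_path_refines[OF x(1) bot_in_NC] by simp
  note nc = noncrossingD[OF NC_noncrossing[OF xNC]]
  have c: "c \<in> NC m" "refines {1..m} x c"
    using good_path_refines[OF x(2) xNC] by auto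
  have tx: "tail_connected k x"
    using good_path_tail_connected[OF x(1) tail_connected_bot] .
  have e: "e \<in> D" "e \<le> k"
    unfolding e_def using NC_block(4)[OF c(1) D(1)] Min_le_in[OF c(1) D(1,2)] by auto
  have e_le: "e \<le> i" if "i \<in> D" for i
    unfolding e_def using Min_le_in[OF c(1) D(1) that] .
  have range: "D \<subseteq> {1..m}"
    using NC_block(1)[OF c(1) D(1)] .
  obtain B where B: "B \<in> x" "e \<in> B"
    using NC_block_ex[OF xNC subsetD[OF range e(1)]] by blast
  obtain C where C: "C \<in> x" "k + 1 \<in> C"
    using NC_block_ex[OF xNC subsetD[OF range D(3)]] by blast
  have BD: "B \<subseteq> D" and CD: "C \<subseteq> D"
    using refines_block_subset[OF c(2,1)] B C D e by blast+
  have "B \<noteq> C"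
    using False B C by (auto simp: U_def e_def)
  have dis: "B \<inter> C = {}"
    using \<open>B \<noteq> C\<close> NC_block_unique[OF xNC B(1) C(1)] by auto
  have H: "\<not> (a < b \<and> b < c' \<and> c' < d) \<and> \<not> (c' < b \<and> b < a \<and> a < d) \<and>
      \<not> (b < a \<and> a < d \<and> d < c') \<and> \<not> (b < c' \<and> c' < d \<and> d < a)"
    if G: "G \<in> x" "G \<noteq> B" "G \<noteq> C" "G \<subseteq> D" and i: "a \<in> B" "c' \<in> C" "b \<in> G" "d \<in> G" for G a b c' d
  proof -
    have "e \<noteq> b"
      using NC_block_unique[OF xNC B(1) G(1) B(2)] i G by auto
    then have eb: "e < b"
      using e_le[of b] i G by auto
    have "k + 1 \<notin> G" "c' \<notin> G"
      using NC_block_unique[OF xNC C(1) G(1)] C i G by auto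
    \<comment> \<open>Beyond \<open>k\<close> the block \<open>G\<close> has no gaps between its
      elements, so \<open>c'\<close> and then also \<open>d\<close> lie below \<open>k + 1\<close>;
      but \<open>b < c' < d < k + 1\<close> is a crossing of \<open>G\<close> and
      \<open>C\<close>.\<close>
    have "\<not> (b < c' \<and> c' < d)"
    proof
      assume lt: "b < c' \<and> c' < d"
      have "c' < k + 1"
        using tail_connected_interval[OF tx xNC G(1) i(3,4), of c'] lt \<open>c' \<notin> G\<close> by linarith
      then have "d < k + 1"
        using tail_connected_interval[OF tx xNC G(1) i(3,4), of "k + 1"] lt \<open>k + 1 \<notin> G\<close> by linarith
      then show False
        using nc[OF G(1) C(1) i(3,2,4) C(2)] lt G by auto
    qed
    then show ?thesis
      using nc[OF B(1) G(1) B(2) i(3) i(1) i(4) eb] G by auto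
  qed
  define y where "y = insert (B \<union> C) (x - {B, C})"
  have y: "y \<in> NC m"
    unfolding y_def by (rule merge_in_NC(1)[OF xNC c(1) c(2) B(1) C(1) D(1) BD CD H])
  have MinB: "Min B = e"
    using B e_le BD NC_block[OF xNC B(1)] by (intro Min_eqI) auto
  have C': "Min C \<in> C" "Min C \<le> k + 1"
    using NC_block(4)[OF xNC C(1)] Min_le_in[OF xNC C] by auto
  have "e \<noteq> Min C"
    using dis B C' by auto
  then have ej: "e < Min C"
    using e_le[of "Min C"] C' CD by auto
  have my: "merges m x y B C"
    unfolding merges_def using xNC y B C ej MinB by (simp add: y_def)
  \<comment> \<open>In \<open>c\<close> the element \<open>k + 1\<close> has joined the block of
    \<open>e\<close>, so the obstruction applies to the path from \<open>x\<close> to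
    \<open>c\<close>.\<close>
  have obs: "k \<notin> B" if "Min C = k + 1"
    using good_path_obstruction[OF x(2) xNC C that D(1,3) _ B(1)] B(2) e by (auto simp: e_def)
  have "(x, y) \<in> good_cover m k"
    using good_coverI[OF my] C'(2) obs by auto
  moreover have "y \<in> U"
    using B C by (auto simp: U_def y_def e_def)
  moreover have "(y, w) \<in> (good_cover m k)\<^sup>*" if w: "w \<in> U" "(x, w) \<in> (good_cover m k)\<^sup>*" for w
  proof -
    have wNC: "w \<in> NC m" and xw: "refines {1..m} x w"
      using good_path_refines[OF w(2) xNC] by auto
    obtain X where X: "X \<in> w" "e \<in> X" "k + 1 \<in> X"
      using w by (auto simp: U_def e_def)
    have "B \<subseteq> X" "C \<subseteq> X"
      using refines_block_subset[OF xw wNC] B C X by blast+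
    then have "refines {1..m} y w"
      using xw X y wNC unfolding refines_def y_def NC_iff by auto
    \<comment> \<open>\<open>B \<union> C\<close> contains \<open>k + 1\<close> and has minimum
      \<open>e\<close>, which is at most \<open>k\<close>; hence refinement suffices for a good
      path.\<close>
    then show ?thesis
      using y wNC good_path_tail_connected[OF w(2) tx] mergesD(10,11)[OF my] C(2) MinB e
      by (intro good_path_if_refines[of y m w k "B \<union> C"]) auto
  qed
  moreover have "\<exists>B\<in>x. k \<in> B \<and> k + 1 \<in> B" if "y = c"
  proof -
    have "D = B \<union> C"
      using NC_block_unique[OF c(1) D(1), of "B \<union> C" e] that e B by (auto simp: y_def)
    \<comment> \<open>With \<open>k \<in> B\<close>, \<open>obs\<close> and disjointness force
      \<open>Min C < k\<close>, so \<open>e < Min C < k < k + 1\<close> is a crossing. Hence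
      \<open>k\<close> lies in \<open>C\<close> with \<open>k + 1\<close>.\<close>
    have "k \<notin> B"
    proof
      assume kB: "k \<in> B"
      then have "Min C \<noteq> k + 1" "Min C \<noteq> k"
        using obs dis C' by auto
      then have "Min C < k"
        using C' by auto
      then show False
        using nc[OF B(1) C(1) B(2) C'(1) kB C(2) ej] \<open>B \<noteq> C\<close> by auto
    qed
    then show ?thesis
      using \<open>D = B \<union> C\<close> D C by auto
  qed
  ultimately show ?thesis
    by blast
qed

text \<open>Joining \<open>1\<close> and \<open>k + 1\<close> first is a good cover because
  \<open>k \<noteq> 1\<close>. Afterwards \<open>k + 1\<close> is no block minimum, and refinement
  suffices.\<close>

lemma bot_top_good_path:
  assumes "1 < k" "k + 1 \<le> m"
  shows "(bot_partition m, top_partition m) \<in> (good_cover m k)\<^sup>*"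
proof -
  let ?\<rho> = "insert ({1} \<union> {k + 1}) (bot_partition m - {{1}, {k + 1}})"
  have m: "1 \<le> m"
    using assms by simp
  have b: "{1} \<in> bot_partition m" "{k + 1} \<in> bot_partition m"
    using assms by (auto simp: bot_partition_def)
  have "?\<rho> \<in> NC m"
    using b m top_in_NC[OF m]
    by (intro merge_in_NC(1)[OF bot_in_NC top_in_NC[OF m] bot_refines[OF top_in_NC[OF m]], of _ _ "{1..m}"])
      (auto simp: top_partition_def bot_partition_def)
  then have my: "merges m (bot_partition m) ?\<rho> {1} {k + 1}"
    unfolding merges_def using b bot_in_NC assms by auto
  then have "(bot_partition m, ?\<rho>) \<in> good_cover m k"
    using assms by (intro good_coverI) auto
  moreover have "(?\<rho>, top_partition m) \<in> (good_cover m k)\<^sup>*"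
    using mergesD(2,10,11)[OF my] m assms top_in_NC refines_top tail_connected_top
    by (intro good_path_if_refines[of _ m _ k "{1} \<union> {k + 1}"]) auto
  ultimately show ?thesis
    by (rule converse_rtrancl_into_rtrancl)
qed

section \<open>Vanishing of the Moebius values\<close>

lemma mobius_eq_0_if_joined:
  fixes m k :: nat
  defines "E \<equiv> {x. (bot_partition m, x) \<in> (good_cover m k)\<^sup>* \<and> (x, top_partition m) \<in> (good_cover m k)\<^sup>*}"
  defines "r \<equiv> Restr ((good_cover m k)\<^sup>*) E"
  assumes fin: "finite E" and po: "partial_order_on E r"
    and "c \<in> E" "D \<in> c" "k \<in> D" "k + 1 \<in> D"
  shows "mobius E r (bot_partition m) c = 0"
  using assms(5-)
\<comment> \<open>Elements strictly below \<open>c\<close> have more blocks, and at most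
  \<open>m\<close> of them.\<close>
proof (induction "m - card c" arbitrary: c D rule: less_induct)
  case less
  let ?G = "(good_cover m k)\<^sup>*" and ?b = "bot_partition m"
  let ?U = "{y. \<exists>B\<in>y. Min D \<in> B \<and> k + 1 \<in> B}"
  have c: "(?b, c) \<in> ?G" "(c, top_partition m) \<in> ?G" "c \<in> NC m"
    using less.prems(1) good_path_refines[OF _ bot_in_NC] by (auto simp: E_def)
  have b: "?b \<in> E"
    using c by (auto simp: E_def)
  \<comment> \<open>\<open>P x y\<close> packages the conclusion of
    \<open>exists_least_join\<close>, so that choice provides the closure map
    \<open>f\<close>.\<close>
  define P where "P x y \<longleftrightarrow> y \<in> ?U \<and> (x, y) \<in> ?G \<and> (\<forall>w\<in>?U. (x, w) \<in> ?G \<longrightarrow> (y, w) \<in> ?G) \<and>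
    (y = c \<longrightarrow> x \<noteq> c \<longrightarrow> (\<exists>B\<in>x. k \<in> B \<and> k + 1 \<in> B))" for x y
  have "\<exists>y. P x y" if "(x, c) \<in> r" for x
    using exists_least_join[of m x k c D] that less.prems unfolding P_def r_def E_def by blast
  then obtain f where f: "\<And>x. (x, c) \<in> r \<Longrightarrow> P x (f x)"
    by metis
  have MinD: "Min D \<in> D" "Min D \<noteq> k + 1"
    using NC_block(4)[OF c(3) less.prems(2)] Min_le_in[OF c(3) less.prems(2,3)] by auto
  then have cU: "c \<in> ?U"
    using less.prems by auto
  have fE: "f x \<in> E \<and> (f x, c) \<in> ?G" if "(x, c) \<in> r" for x
  proof -
    \<comment> \<open>\<open>c\<close> is closed, so leastness puts \<open>f x\<close> below
      \<open>c\<close>.\<close>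
    have "(f x, c) \<in> ?G" "(x, f x) \<in> ?G"
      using f[OF that] cU that unfolding P_def r_def by auto
    then show ?thesis
      using that c unfolding r_def E_def by (auto intro: rtrancl_trans)
  qed
  have zero: "(\<Sum>x | (x, c) \<in> r \<and> f x = c. mobius E r ?b x) = 0"
  proof (rule sum_mobius_closure_fibre[OF fin po])
    show "(?b, x) \<in> r" if "x \<in> E" for x
      using that b unfolding r_def E_def by auto
    \<comment> \<open>A singleton cannot contain the distinct elements \<open>Min D\<close> and
      \<open>k + 1\<close>.\<close>
    show "?b \<notin> ?U"
      using MinD by (auto simp: bot_partition_def)
    show "(x, f x) \<in> r \<and> f x \<in> ?U" if "(x, c) \<in> r" for x
      using f[OF that] fE[OF that] that unfolding P_def r_def by auto
    show "(f x, y) \<in> r" if "(x, y) \<in> r" "(y, c) \<in> r" "y \<in> ?U" for x y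
    proof -
      have xc: "(x, c) \<in> r"
        using that unfolding r_def by (auto intro: rtrancl_trans)
      show ?thesis
        using f[OF xc] fE[OF xc] that unfolding P_def r_def by auto
    qed
  qed (use cU less.prems in auto)
  have cc: "(c, c) \<in> r"
    using less.prems by (simp add: r_def)
  then have "f c = c"
    using f[OF cc] fE[OF cc] po cU less.prems
    unfolding P_def partial_order_on_def r_def by (auto dest: antisymD)
  \<comment> \<open>The other members of the fibre have \<open>k\<close> and \<open>k + 1\<close> in
    one block, so the induction hypothesis covers them, possibly with another block in place of
    \<open>D\<close>.\<close>
  have rest: "mobius E r ?b x = 0" if x_c: "(x, c) \<in> r" "f x = c" "x \<noteq> c" for x
  proof -
    have x: "(?b, x) \<in> ?G" "(x, c) \<in> ?G" "x \<in> E"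
      using that by (auto simp: r_def E_def)
    then have xNC: "x \<in> NC m"
      using good_path_refines[OF _ bot_in_NC] by blast
    have "card c < card x \<and> card x \<le> m"
    proof -
      have mono: "card \<tau> \<le> card \<sigma>" if "(\<sigma>, \<tau>) \<in> ?G" for \<sigma> \<tau>
        using that by (induction rule: rtrancl_induct) (auto elim!: good_coverE dest!: card_merges)
      obtain y where "(x, y) \<in> good_cover m k" "(y, c) \<in> ?G"
        using x(2) x_c(3) by (auto elim: converse_rtranclE)
      then have "card c < card x"
        using mono[of y c] by (auto elim!: good_coverE dest!: card_merges)
      moreover have "card ?b = m"
        unfolding bot_partition_def by (subst card_image) auto
      ultimately show ?thesis
        using mono[OF x(1)] by simp
    qed
    moreover have "f x = c \<longrightarrow> x \<noteq> c \<longrightarrow> (\<exists>B\<in>x. k \<in> B \<and> k + 1 \<in> B)"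
      using f[OF x_c(1)] unfolding P_def by (elim conjE)
    then obtain B where "B \<in> x" "k \<in> B" "k + 1 \<in> B"
      using x_c by blast
    ultimately show ?thesis
      using x by (intro less.hyps[of x B]) auto
  qed
  have "finite {x. (x, c) \<in> r \<and> f x = c}"
    using fin by (rule finite_subset[rotated]) (auto simp: r_def)
  then have "mobius E r ?b c = (\<Sum>x | (x, c) \<in> r \<and> f x = c. mobius E r ?b x)"
    using cc \<open>f c = c\<close> rest by (subst sum.remove[of _ c]) auto
  with zero show ?case
    by simp
qed

subsection \<open>Maximal chains and their labels\<close>

lemma union_of_blocks_notin:
  assumes "\<sigma> \<in> NC m" "B \<in> \<sigma>" "C \<in> \<sigma>" "B \<noteq> C"
  shows "B \<union> C \<notin> \<sigma>"
proof -
  obtain x y where "x \<in> B" "y \<in> C"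
    using NC_block(3)[OF assms(1)] assms by blast
  then show ?thesis
    using NC_block_unique[OF assms(1,2), of "B \<union> C" x] NC_block_unique[OF assms(1,3), of "B \<union> C" y] assms(4)
    by auto
qed

text \<open>The difference of \<open>\<sigma>\<close> and \<open>\<tau>\<close> recovers the pair of
  merged blocks, and the minimum of their union tells which one comes first; so the description in
  \<open>cover_label\<close> has a unique solution.\<close>

lemma cover_label_merges:
  assumes "merges m \<sigma> \<tau> B C"
  shows "cover_label \<sigma> \<tau> = Max {i \<in> B. i < Min C}"
proof -
  note * = mergesD[OF assms]
  have C: "C \<noteq> {}"
    using NC_block(3)[OF *(1,4)] .
  have less: "{j \<in> B. \<forall>l\<in>C. j < l} = {i \<in> B. i < Min C}"
    using *(13) C by auto
  have diff: "\<sigma> - insert (X \<union> Y) (\<sigma> - {X, Y}) = {X, Y}" if "X \<in> \<sigma>" "Y \<in> \<sigma>" "X \<noteq> Y" for X Y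
    using union_of_blocks_notin[OF *(1) that] that by auto
  show ?thesis
    unfolding cover_label_def
  proof (rule the_equality)
    have "Min (B \<union> C) \<in> B"
      using NC_block(4)[OF *(1,3)] *(11) by simp
    then show "\<exists>B1\<in>\<sigma>. \<exists>B2\<in>\<sigma>. B1 \<noteq> B2 \<and> \<tau> = insert (B1 \<union> B2) (\<sigma> - {B1, B2}) \<and>
        Min (B1 \<union> B2) \<in> B1 \<and> Max {i \<in> B. i < Min C} = Max {j \<in> B1. \<forall>l\<in>B2. j < l}"
      using * less by (intro bexI[of _ B] bexI[of _ C]) auto
  next
    fix i
    assume "\<exists>B1\<in>\<sigma>. \<exists>B2\<in>\<sigma>. B1 \<noteq> B2 \<and> \<tau> = insert (B1 \<union> B2) (\<sigma> - {B1, B2}) \<and>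
        Min (B1 \<union> B2) \<in> B1 \<and> i = Max {j \<in> B1. \<forall>l\<in>B2. j < l}"
    then obtain X Y where XY: "X \<in> \<sigma>" "Y \<in> \<sigma>" "X \<noteq> Y" "\<tau> = insert (X \<union> Y) (\<sigma> - {X, Y})"
      "Min (X \<union> Y) \<in> X" "i = Max {j \<in> X. \<forall>l\<in>Y. j < l}"
      by blast
    have "{X, Y} = {B, C}"
      using diff[OF XY(1-3)] diff[OF *(3,4,7)] XY(4) *(6) by simp
    then have "X = B \<and> Y = C \<or> X = C \<and> Y = B"
      by (auto simp: doubleton_eq_iff)
    moreover have "\<not> (X = C \<and> Y = B)"
    proof
      assume "X = C \<and> Y = B"
      then have "Min (B \<union> C) \<in> C"
        using XY(5) by (simp add: Un_commute)
      then show False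
        using NC_block(4)[OF *(1,3)] *(8,11) by auto
    qed
    ultimately show "i = Max {i \<in> B. i < Min C}"
      using XY(6) less by simp
  qed
qed

lemma Max_below_Min:
  assumes "merges m \<sigma> \<tau> B C"
  defines "l \<equiv> Max {i \<in> B. i < Min C}"
  shows "l \<in> B" "l < Min C" "1 \<le> l" "\<And>i. i \<in> B \<Longrightarrow> i < Min C \<Longrightarrow> i \<le> l"
proof -
  note * = mergesD[OF assms(1)]
  have fin: "finite {i \<in> B. i < Min C}"
    using *(12) by simp
  have "Min B \<in> {i \<in> B. i < Min C}"
    using NC_block(4)[OF *(1,3)] *(5) by simp
  then have "l \<in> {i \<in> B. i < Min C}"
    unfolding l_def using fin by (intro Max_in) auto
  then show "l \<in> B" "l < Min C"
    by auto
  then show "1 \<le> l"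
    using NC_block(1)[OF *(1,3)] by auto
  show "i \<le> l" if "i \<in> B" "i < Min C" for i
    unfolding l_def using fin that by (intro Max_ge) auto
qed

text \<open>Iterating \<open>exists_merge\<close> climbs from \<open>\<sigma>\<close> to
  \<open>\<tau>\<close>, and every merge loses one block.\<close>

lemma card_less_if_refines:
  assumes "\<sigma> \<in> NC m" "\<tau> \<in> NC m" "refines {1..m} \<sigma> \<tau>" "\<sigma> \<noteq> \<tau>"
  shows "card \<tau> < card \<sigma>"
  using assms
proof (induction "card \<sigma>" arbitrary: \<sigma> rule: less_induct)
  case less
  obtain \<rho> B C D where \<rho>: "merges m \<sigma> \<rho> B C" "refines {1..m} \<rho> \<tau>"
    using exists_merge[OF less.prems] by metis
  show ?case
  proof (cases "\<rho> = \<tau>")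
    case True
    then show ?thesis
      using card_merges[OF \<rho>(1)] by simp
  next
    case False
    then show ?thesis
      using less.hyps[OF _ mergesD(2)[OF \<rho>(1)] less.prems(2) \<rho>(2)] card_merges[OF \<rho>(1)] by simp
  qed
qed

lemma card_bot: "card (bot_partition m) = m"
  unfolding bot_partition_def by (subst card_image) auto

lemma card_NC_elem:
  assumes "1 \<le> m" "\<sigma> \<in> NC m"
  shows "card \<sigma> \<in> {1..m}"
proof -
  have "card \<sigma> \<le> m"
    using card_less_if_refines[OF bot_in_NC assms(2) bot_refines[OF assms(2)]] card_bot[of m]
    by (cases "\<sigma> = bot_partition m") auto
  moreover obtain B where "B \<in> \<sigma>"
    using NC_block_ex[OF assms(2), of 1] assms(1) by auto
  then have "card \<sigma> \<noteq> 0"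
    using finite_NC_elem[OF assms(2)] by auto
  ultimately show ?thesis
    by simp
qed

section \<open>Maximal chains as sequences of merges\<close>

lemma nc_less_trans: "nc_less m x y \<Longrightarrow> nc_less m y z \<Longrightarrow> nc_less m x z"
  unfolding nc_less_def using refines_trans refines_asym by metis

lemma nc_less_not_refines: "nc_less m x y \<Longrightarrow> \<not> refines {1..m} y x"
  unfolding nc_less_def using refines_asym by metis

text \<open>An explicit form of the maximal chains, as \<open>nc_maxchains_iff\<close>
  shows.\<close>

definition merge_chain :: "nat \<Rightarrow> nat set set list \<Rightarrow> bool" where
  "merge_chain m c \<longleftrightarrow> c \<noteq> [] \<and> hd c = bot_partition m \<and> last c = top_partition m \<and>
     (\<forall>i. Suc i < length c \<longrightarrow> (\<exists>B C. merges m (c ! i) (c ! Suc i) B C))"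

lemma maxchain_absorb:
  assumes "pred_on.maxchain A P S" "z \<in> A" "\<And>x. x \<in> S \<Longrightarrow> x = z \<or> P x z \<or> P z x"
  shows "z \<in> S"
proof (rule ccontr)
  assume "z \<notin> S"
  have S: "pred_on.chain A P S"
    using assms(1) by (simp add: pred_on.maxchain_def)
  have "pred_on.chain A P (insert z S)"
    using S assms(2,3) unfolding pred_on.chain_def by auto
  then show False
    using assms(1) \<open>z \<notin> S\<close> unfolding pred_on.maxchain_def by auto
qed

text \<open>A maximal chain contains every partition comparable to all its members: the bottom, the
  top, and a merge between any two consecutive members.\<close>

lemma merge_chain_if_maxchain:
  assumes m: "1 \<le> m" and c: "c \<in> nc_maxchains m"
  shows "merge_chain m c"
proof -
  have sorted: "sorted_wrt (nc_less m) c" and max: "pred_on.maxchain (NC m) (nc_less m) (set c)"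
    using c by (auto simp: nc_maxchains_def)
  have setNC: "x \<in> NC m" if "x \<in> set c" for x
    using max that unfolding pred_on.maxchain_def pred_on.chain_def by auto
  then have NC: "c ! i \<in> NC m" if "i < length c" for i
    using that by simp
  have less: "nc_less m (c ! i) (c ! j)" if "i < j" "j < length c" for i j
    using sorted that by (simp add: sorted_wrt_iff_nth_less)
  have "bot_partition m \<in> set c"
    using max bot_in_NC
  proof (rule maxchain_absorb)
    fix x assume "x \<in> set c"
    then have "refines {1..m} (bot_partition m) x"
      by (intro bot_refines setNC)
    then show "x = bot_partition m \<or> nc_less m x (bot_partition m) \<or> nc_less m (bot_partition m) x"
      by (auto simp: nc_less_def)
  qed
  then obtain i where i: "i < length c" "c ! i = bot_partition m"
    by (auto simp: in_set_conv_nth)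
  then have ne: "c \<noteq> []"
    by auto
  have "i = 0"
  proof (rule ccontr)
    assume "i \<noteq> 0"
    then have "nc_less m (c ! 0) (bot_partition m)"
      using less[of 0 i] i by simp
    moreover have "refines {1..m} (bot_partition m) (c ! 0)"
      using ne by (intro bot_refines NC) simp
    ultimately show False
      using nc_less_not_refines by blast
  qed
  then have hd: "hd c = bot_partition m"
    using i ne by (simp add: hd_conv_nth)
  have "top_partition m \<in> set c"
    using max top_in_NC[OF m]
  proof (rule maxchain_absorb)
    fix x assume "x \<in> set c"
    then have "refines {1..m} x (top_partition m)"
      by (intro refines_top[OF m] setNC)
    then show "x = top_partition m \<or> nc_less m x (top_partition m) \<or> nc_less m (top_partition m) x"
      by (auto simp: nc_less_def)
  qed
  then obtain l where l: "l < length c" "c ! l = top_partition m"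
    by (auto simp: in_set_conv_nth)
  have "\<not> l < length c - 1"
  proof
    assume *: "l < length c - 1"
    then have "nc_less m (top_partition m) (c ! (length c - 1))"
      using less[of l "length c - 1"] l by simp
    moreover have "refines {1..m} (c ! (length c - 1)) (top_partition m)"
      using ne by (intro refines_top[OF m] NC) simp
    ultimately show False
      using nc_less_not_refines by blast
  qed
  then have "l = length c - 1"
    using l by simp
  then have last: "last c = top_partition m"
    using l ne by (simp add: last_conv_nth)
  have "\<exists>B C. merges m (c ! i) (c ! Suc i) B C" if i: "Suc i < length c" for i
  proof -
    have 1: "nc_less m (c ! i) (c ! Suc i)"
      using less[of i "Suc i"] i by simp
    then have "refines {1..m} (c ! i) (c ! Suc i)" "c ! i \<noteq> c ! Suc i"
      by (auto simp: nc_less_def)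
    \<comment> \<open>\<open>\<rho>\<close> lies strictly above \<open>c ! i\<close> and weakly
      below \<open>c ! Suc i\<close>. It thus belongs to the chain, and its only possible position
      is \<open>Suc i\<close>.\<close>
    then obtain \<rho> B C D where \<rho>: "merges m (c ! i) \<rho> B C" "refines {1..m} \<rho> (c ! Suc i)"
      using exists_merge[OF NC[of i] NC[of "Suc i"]] i by (metis Suc_lessD)
    have "card \<rho> \<noteq> card (c ! i)"
      using card_merges[OF \<rho>(1)] by simp
    then have lt: "nc_less m (c ! i) \<rho>"
      using merges_refines[OF \<rho>(1)] by (auto simp: nc_less_def)
    have le: "\<rho> = c ! Suc i \<or> nc_less m \<rho> (c ! Suc i)"
      using \<rho>(2) by (auto simp: nc_less_def)
    have cmp: "nc_less m (c ! j) \<rho>" if "j \<le> i" for j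
      using that lt less[of j i] i nc_less_trans[of m "c ! j" "c ! i" \<rho>] by (cases "j = i") auto
    have cmp': "\<rho> = c ! j \<or> nc_less m \<rho> (c ! j)" "j \<noteq> Suc i \<Longrightarrow> nc_less m \<rho> (c ! j)"
      if "Suc i \<le> j" "j < length c" for j
      using that le less[of "Suc i" j] nc_less_trans[of m \<rho> "c ! Suc i" "c ! j"] by (cases "j = Suc i"; auto)+
    have "\<rho> \<in> set c"
      using max mergesD(2)[OF \<rho>(1)]
    proof (rule maxchain_absorb)
      fix x assume "x \<in> set c"
      then obtain j where "j < length c" "x = c ! j"
        by (auto simp: in_set_conv_nth)
      then show "x = \<rho> \<or> nc_less m x \<rho> \<or> nc_less m \<rho> x"
        using cmp[of j] cmp'(1)[of j] by (cases "j \<le> i") auto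
    qed
    then obtain j where j: "j < length c" "\<rho> = c ! j"
      by (auto simp: in_set_conv_nth)
    have "j = Suc i"
      using cmp[of j] cmp'(2)[of j] j by (cases "j \<le> i") (auto simp: nc_less_def)
    with j \<rho>(1) show ?thesis
      by blast
  qed
  with ne hd last show ?thesis
    by (simp add: merge_chain_def)
qed

lemma merge_chain_nth_in_NC:
  assumes "1 \<le> m" "merge_chain m c" "i < length c"
  shows "c ! i \<in> NC m"
proof (cases "Suc i < length c")
  case True
  then obtain B C where "merges m (c ! i) (c ! Suc i) B C"
    using assms unfolding merge_chain_def by blast
  then show ?thesis
    by (rule mergesD)
next
  case False
  then have "i = length c - 1"
    using assms(3) by simp
  then have "c ! i = top_partition m"
    using assms(2) by (auto simp: merge_chain_def last_conv_nth)
  then show ?thesis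
    using top_in_NC[OF assms(1)] by simp
qed

lemma length_merge_chain:
  assumes m: "1 \<le> m" and c: "merge_chain m c"
  shows "length c = m"
proof -
  have card: "card (c ! i) + i = m" if "i < length c" for i
    using that
  proof (induction i)
    case 0
    then show ?case
      using c by (simp add: merge_chain_def hd_conv_nth card_bot)
  next
    case (Suc i)
    then obtain B C where "merges m (c ! i) (c ! Suc i) B C"
      using c unfolding merge_chain_def by blast
    then show ?case
      using Suc card_merges[of m "c ! i" "c ! Suc i" B C] by simp
  qed
  have "c ! (length c - 1) = top_partition m" and "c \<noteq> []"
    using c by (auto simp: merge_chain_def last_conv_nth)
  then show ?thesis
    using card[of "length c - 1"] by (simp add: top_partition_def)
qed

text \<open>The number of blocks is injective on any chain, with values in \<open>{1..m}\<close>. A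
  merge chain already has \<open>m\<close> members, so no chain properly contains it.\<close>

lemma maxchain_if_merge_chain:
  assumes m: "1 \<le> m" and c: "merge_chain m c"
  shows "c \<in> nc_maxchains m"
proof -
  have "transp (nc_less m)"
    using nc_less_trans by (auto simp: transp_def)
  moreover have "nc_less m (c ! i) (c ! Suc i)" if i: "Suc i < length c" for i
  proof -
    obtain B C where BC: "merges m (c ! i) (c ! Suc i) B C"
      using c i unfolding merge_chain_def by blast
    show ?thesis
      using merges_refines[OF BC] card_merges[OF BC] by (auto simp: nc_less_def)
  qed
  ultimately have sorted: "sorted_wrt (nc_less m) c"
    by (simp add: sorted_wrt_iff_nth_Suc_transp)
  have less: "nc_less m (c ! i) (c ! j)" if "i < j" "j < length c" for i j
    using sorted that by (simp add: sorted_wrt_iff_nth_less)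
  have sub: "set c \<subseteq> NC m"
    using merge_chain_nth_in_NC[OF m c] by (auto simp: in_set_conv_nth)
  have "pred_on.chain (NC m) (nc_less m) (set c)"
    unfolding pred_on.chain_def
  proof (intro conjI ballI sub)
    fix x y assume "x \<in> set c" "y \<in> set c"
    then obtain i j where "i < length c" "x = c ! i" "j < length c" "y = c ! j"
      by (auto simp: in_set_conv_nth)
    then show "(nc_less m)\<^sup>=\<^sup>= x y \<or> (nc_less m)\<^sup>=\<^sup>= y x"
      using less[of i j] less[of j i] by (cases i j rule: linorder_cases) auto
  qed
  moreover have False if S: "pred_on.chain (NC m) (nc_less m) S" "set c \<subset> S" for S
  proof -
    have SNC: "S \<subseteq> NC m"
      using S(1) by (simp add: pred_on.chain_def)
    have lt: "card y < card x" if "nc_less m x y" "x \<in> S" "y \<in> S" for x y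
      using that SNC by (intro card_less_if_refines[of x m y]) (auto simp: nc_less_def)
    have inj: "inj_on card S"
    proof (rule inj_onI)
      fix x y assume xy: "x \<in> S" "y \<in> S" "card x = card y"
      then have "x = y \<or> nc_less m x y \<or> nc_less m y x"
        using S(1) by (auto simp: pred_on.chain_def)
      then show "x = y"
        using lt[of x y] lt[of y x] xy by auto
    qed
    have img: "card ` S \<subseteq> {1..m}"
      using SNC card_NC_elem[OF m] by (intro image_subsetI) auto
    then have "finite S"
      using inj by (metis finite_atLeastAtMost finite_imageD finite_subset)
    moreover have "card S \<le> m"
      using card_mono[OF _ img] card_image[OF inj] by simp
    moreover have "distinct c"
      unfolding distinct_conv_nth
    proof (intro allI impI)
      fix i j assume "i < length c" "j < length c" "i \<noteq> j"
      then show "c ! i \<noteq> c ! j"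
        using less[of i j] less[of j i] by (cases i j rule: linorder_cases) (auto simp: nc_less_def)
    qed
    then have "card (set c) = m"
      using length_merge_chain[OF m c] by (simp add: distinct_card)
    ultimately show False
      using psubset_card_mono[of S "set c"] S(2) by simp
  qed
  ultimately show ?thesis
    using sorted unfolding nc_maxchains_def pred_on.maxchain_def by auto
qed

lemma nc_maxchains_iff: "1 \<le> m \<Longrightarrow> c \<in> nc_maxchains m \<longleftrightarrow> merge_chain m c"
  using merge_chain_if_maxchain maxchain_if_merge_chain by blast

text \<open>Every \<open>j \<noteq> 1\<close> ceases to be the minimum of its block at exactly one step of the chain.\<close>

lemma absorbed_bij:
  assumes m: "1 \<le> m" and c: "merge_chain m c"
    and BC: "\<And>i. Suc i < length c \<Longrightarrow> merges m (c ! i) (c ! Suc i) (B i) (C i)"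
  shows "bij_betw (\<lambda>i. Min (C i)) {..<m - 1} {2..m}"
proof -
  let ?j = "\<lambda>i. Min (C i)"
  have len: "length c = m"
    by (rule length_merge_chain[OF m c])
  have inj_NC: "inj_on Min \<sigma>" if "\<sigma> \<in> NC m" for \<sigma>
  proof (rule inj_onI)
    fix X Y assume "X \<in> \<sigma>" "Y \<in> \<sigma>" "Min X = Min Y"
    then show "X = Y"
      using NC_block_unique[OF that, of X Y "Min X"] NC_block(4)[OF that, of X] NC_block(4)[OF that, of Y]
      by simp
  qed
  \<comment> \<open>\<open>Min\<close> is injective on blocks, so a merge removes exactly
    \<open>Min (C i)\<close> from the set of block minima.\<close>
  have step: "Min ` (c ! Suc i) = Min ` (c ! i) - {?j i} \<and> ?j i \<in> Min ` (c ! i) \<and> 2 \<le> ?j i"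
    if i: "Suc i < length c" for i
  proof -
    note * = mergesD[OF BC[OF i]]
    have "Min ` (c ! Suc i) = insert (Min (B i)) (Min ` (c ! i - {B i, C i}))"
      unfolding *(6) using *(11) by simp
    also have "Min ` (c ! i - {B i, C i}) = Min ` (c ! i) - {Min (B i), ?j i}"
      using inj_on_image_set_diff[OF inj_NC[OF *(1)], of "c ! i" "{B i, C i}"] *(3,4) by simp
    finally have 1: "Min ` (c ! Suc i) = Min ` (c ! i) - {?j i}"
      using *(3,5) by auto
    have "1 \<le> Min (B i)"
      using NC_block(1,4)[OF *(1,3)] by auto
    then have "2 \<le> ?j i"
      using *(5) by simp
    with 1 *(4) show ?thesis
      by blast
  qed
  have mins: "Min ` (c ! i) = {1..m} - ?j ` {..<i}" if "i < length c" for i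
    using that
  proof (induction i)
    case 0
    then show ?case
      using c by (auto simp: merge_chain_def hd_conv_nth bot_partition_def image_image)
  next
    case (Suc i)
    then show ?case
      using step[OF Suc.prems] by (auto simp: lessThan_Suc)
  qed
  have notin: "?j i \<in> {2..m} \<and> ?j i \<notin> ?j ` {..<i}" if "i < m - 1" for i
    using step[of i] mins[of i] that len by auto
  have "inj_on ?j {..<m - 1}"
  proof (rule linorder_inj_onI)
    fix x y assume "x < y" "x \<in> {..<m - 1}" "y \<in> {..<m - 1}"
    then have "?j x \<in> ?j ` {..<y}" "?j y \<notin> ?j ` {..<y}"
      using notin[of y] by auto
    then show "?j x \<noteq> ?j y"
      by metis
  qed auto
  moreover have "?j ` {..<m - 1} \<subseteq> {2..m}"
    using notin by auto
  ultimately show ?thesis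
    unfolding bij_betw_def by (simp add: card_subset_eq card_image)
qed

section \<open>Which label sequences are parking functions of the required kind\<close>

text \<open>Each of the \<open>i\<close> values from \<open>2\<close> to \<open>i + 1\<close> is
  some \<open>j t\<close>, and then \<open>a ! t < j t\<close> makes \<open>a ! t\<close> at most
  \<open>i\<close>. So at least \<open>i\<close> entries are at most \<open>i\<close>.\<close>

lemma PF_if_absorbed_bij:
  assumes len: "length a = n" and bij: "bij_betw j {..<n} {2..n + 1}"
    and a: "\<And>t. t < n \<Longrightarrow> 1 \<le> a ! t \<and> a ! t < j t"
  shows "a \<in> PF n"
proof -
  have "sort a ! (i - 1) \<le> i" if i: "i \<in> {1..n}" for i
  proof (rule ccontr)
    assume gt: "\<not> sort a ! (i - 1) \<le> i"
    \<comment> \<open>If the \<open>i\<close>-th smallest entry, at index \<open>i - 1\<close>,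
      exceeds \<open>i\<close>, all entries up to \<open>i\<close> come before it.\<close>
    have "{t. t < length (sort a) \<and> sort a ! t \<le> i} \<subseteq> {..<i - 1}"
    proof
      fix t assume t: "t \<in> {t. t < length (sort a) \<and> sort a ! t \<le> i}"
      show "t \<in> {..<i - 1}"
        using t gt sorted_nth_mono[OF sorted_sort, of "i - 1" t a] by (force simp: not_less)
    qed
    then have "card {t. t < length (sort a) \<and> sort a ! t \<le> i} \<le> card {..<i - 1}"
      by (intro card_mono) auto
    then have "length (filter (\<lambda>x. x \<le> i) (sort a)) \<le> i - 1"
      by (simp only: length_filter_conv_card card_lessThan)
    then have 1: "card {t. t < n \<and> a ! t \<le> i} \<le> i - 1"
      by (simp add: filter_sort length_filter_conv_card len)
    have inj: "inj_on j {..<n}" and img: "j ` {..<n} = {2..n + 1}"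
      using bij by (auto simp: bij_betw_def)
    have "{2..i + 1} \<subseteq> j ` {t. t < n \<and> a ! t \<le> i}"
    proof
      fix x assume x: "x \<in> {2..i + 1}"
      then have "x \<in> j ` {..<n}"
        unfolding img using i by auto
      then obtain t where "t < n" "x = j t"
        by auto
      then show "x \<in> j ` {t. t < n \<and> a ! t \<le> i}"
        using a[of t] x by auto
    qed
    then have "card {2..i + 1} \<le> card (j ` {t. t < n \<and> a ! t \<le> i})"
      by (intro card_mono) auto
    also have "\<dots> \<le> card {t. t < n \<and> a ! t \<le> i}"
      by (rule card_image_le) auto
    finally show False
      using 1 i by auto
  qed
  moreover have "\<forall>x\<in>set a. 1 \<le> x"
    using a len by (auto simp: in_set_conv_nth)
  ultimately show ?thesis
    using len by (simp add: PF_def)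
qed

text \<open>From left to right, induct downwards from \<open>j t = n + 1\<close>: the value
  \<open>j t - 1\<close> occurs at some \<open>t'\<close> with \<open>j t'\<close> at least
  \<open>j t\<close>. A larger \<open>j t'\<close> would already have the entry
  \<open>j t' - 1\<close>, so \<open>t' = t\<close>.\<close>

lemma PFk_iff_absorbed:
  assumes len: "length a = n" and bij: "bij_betw j {..<n} {2..n + 1}"
    and a: "\<And>t. t < n \<Longrightarrow> 1 \<le> a ! t \<and> a ! t < j t"
  shows "a \<in> PFk n k \<longleftrightarrow> (\<forall>t<n. (k + 1 < j t \<longrightarrow> a ! t = j t - 1) \<and> (j t = k + 1 \<longrightarrow> a ! t \<noteq> k))"
proof
  assume "a \<in> PFk n k"
  then have k: "k \<notin> set a" and big: "\<And>i. i \<in> {k+1..n} \<Longrightarrow> i \<in> set a"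
    by (auto simp: PFk_def)
  have inj: "inj_on j {..<n}" and img: "j ` {..<n} = {2..n + 1}"
    using bij by (auto simp: bij_betw_def)
  have tail: "a ! t = j t - 1" if "t < n" "k + 1 < j t" for t
    using that
  proof (induction "n + 1 - j t" arbitrary: t rule: less_induct)
    case less
    have "j t \<in> {2..n + 1}"
      using less.prems img by auto
    then have "j t - 1 \<in> set a"
      using less.prems by (intro big) auto
    then obtain t' where t': "t' < n" "a ! t' = j t - 1"
      using len by (auto simp: in_set_conv_nth)
    have le: "j t \<le> j t'"
      using a[OF t'(1)] t'(2) by linarith
    have "\<not> j t < j t'"
    proof
      assume gt: "j t < j t'"
      have "j t' \<in> {2..n + 1}"
        using t'(1) img by auto
      then have "a ! t' = j t' - 1"
        using gt less.prems by (intro less.hyps t'(1)) auto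
      with t'(2) gt less.prems(2) show False
        by linarith
    qed
    with le have "j t = j t'"
      by simp
    then have "t = t'"
      using inj less.prems(1) t'(1) by (auto dest: inj_onD)
    with t'(2) show ?case
      by simp
  qed
  have "a ! t \<noteq> k" if "t < n" for t
    using k that len by (auto simp: in_set_conv_nth)
  with tail show "\<forall>t<n. (k + 1 < j t \<longrightarrow> a ! t = j t - 1) \<and> (j t = k + 1 \<longrightarrow> a ! t \<noteq> k)"
    by simp
next
  assume R: "\<forall>t<n. (k + 1 < j t \<longrightarrow> a ! t = j t - 1) \<and> (j t = k + 1 \<longrightarrow> a ! t \<noteq> k)"
  \<comment> \<open>The entry is below \<open>k\<close> if \<open>j t < k + 1\<close> and above
    \<open>k\<close> if \<open>j t > k + 1\<close>; the case of equality is excluded by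
    \<open>R\<close>.\<close>
  have "a ! t \<noteq> k" if "t < n" for t
  proof (cases "j t" "k + 1" rule: linorder_cases)
    case less
    then show ?thesis using a[OF that] by simp
  next
    case equal
    then show ?thesis using R that by simp
  next
    case greater
    then have "a ! t = j t - 1"
      using R that by simp
    with greater show ?thesis by simp
  qed
  then have "k \<notin> set a"
    using len by (auto simp: in_set_conv_nth)
  moreover have "i \<in> set a" if i: "i \<in> {k+1..n}" for i
  proof -
    have "i + 1 \<in> j ` {..<n}"
      using bij i by (auto simp: bij_betw_def)
    then obtain t where t: "t < n" "j t = i + 1"
      by auto
    then have "a ! t = i"
      using R i by auto
    with t(1) len show ?thesis
      by (auto simp: in_set_conv_nth)
  qed
  ultimately show "a \<in> PFk n k"
    using PF_if_absorbed_bij[OF len bij a] by (simp add: PFk_def)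
qed

definition good_chain :: "nat \<Rightarrow> nat \<Rightarrow> nat set set list \<Rightarrow> bool" where
  "good_chain m k c \<longleftrightarrow> c \<noteq> [] \<and> hd c = bot_partition m \<and> last c = top_partition m \<and>
     successively (\<lambda>x y. (x, y) \<in> good_cover m k) c"

text \<open>The largest element of \<open>B i\<close> below \<open>Min (C i)\<close> equals
  \<open>Min (C i) - 1\<close> exactly when that number lies in \<open>B i\<close>; for
  \<open>Min (C i) = k + 1\<close> this number is \<open>k\<close>.\<close>

lemma chain_labels_in_PFk_iff:
  assumes c: "merge_chain (n + 1) c"
    and BC: "\<And>i. Suc i < length c \<Longrightarrow> merges (n + 1) (c ! i) (c ! Suc i) (B i) (C i)"
  shows "chain_labels c \<in> PFk n k \<longleftrightarrow>
    (\<forall>i<n. (k + 1 < Min (C i) \<longrightarrow> Min (C i) - 1 \<in> B i) \<and> (Min (C i) = k + 1 \<longrightarrow> k \<notin> B i))"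
proof -
  have len: "length c = n + 1"
    using length_merge_chain[OF _ c] by simp
  define l where "l i = Max {x \<in> B i. x < Min (C i)}" for i
  have BC': "merges (n + 1) (c ! i) (c ! Suc i) (B i) (C i)" if "i < n" for i
    using BC[of i] that len by simp
  have lab: "length (chain_labels c) = n" "\<And>i. i < n \<Longrightarrow> chain_labels c ! i = l i"
    using len cover_label_merges[OF BC'] by (simp_all add: chain_labels_def l_def)
  note l = Max_below_Min[OF BC', folded l_def]
  have "bij_betw (\<lambda>i. Min (C i)) {..<n} {2..n + 1}"
    using absorbed_bij[OF _ c, of B C] BC by simp
  then have "chain_labels c \<in> PFk n k \<longleftrightarrow>
    (\<forall>i<n. (k + 1 < Min (C i) \<longrightarrow> l i = Min (C i) - 1) \<and> (Min (C i) = k + 1 \<longrightarrow> l i \<noteq> k))"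
    using PFk_iff_absorbed[OF lab(1), of "\<lambda>i. Min (C i)" k] lab(2) l(2,3) by simp
  also have "\<dots> \<longleftrightarrow>
    (\<forall>i<n. (k + 1 < Min (C i) \<longrightarrow> Min (C i) - 1 \<in> B i) \<and> (Min (C i) = k + 1 \<longrightarrow> k \<notin> B i))"
  proof (intro all_cong imp_cong refl arg_cong2[where f = "(\<and>)"])
    fix i assume i: "i < n"
    show "l i = Min (C i) - 1 \<longleftrightarrow> Min (C i) - 1 \<in> B i" if "k + 1 < Min (C i)"
      using l(1,2)[OF i] l(4)[OF i, of "Min (C i) - 1"] that by fastforce
    show "l i \<noteq> k \<longleftrightarrow> k \<notin> B i" if "Min (C i) = k + 1"
      using l(1,2)[OF i] l(4)[OF i, of k] that by fastforce
  qed
  finally show ?thesis .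
qed

lemma chains_of_PFk_iff: "c \<in> chains_of n (PFk n k) \<longleftrightarrow> good_chain (n + 1) k c"
proof
  assume "c \<in> chains_of n (PFk n k)"
  then have c: "merge_chain (n + 1) c" and lab: "chain_labels c \<in> PFk n k"
    by (auto simp: chains_of_def nc_maxchains_iff)
  have "\<forall>i. \<exists>B C. Suc i < length c \<longrightarrow> merges (n + 1) (c ! i) (c ! Suc i) B C"
    using c by (auto simp: merge_chain_def)
  then obtain B C where BC: "\<And>i. Suc i < length c \<Longrightarrow> merges (n + 1) (c ! i) (c ! Suc i) (B i) (C i)"
    by metis
  have len: "length c = n + 1"
    using length_merge_chain[OF _ c] by simp
  have "(c ! i, c ! Suc i) \<in> good_cover (n + 1) k" if i: "Suc i < length c" for i
    using chain_labels_in_PFk_iff[OF c BC, of k] lab i len by (intro good_coverI[OF BC[OF i]]) auto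
  then show "good_chain (n + 1) k c"
    using c by (simp add: good_chain_def merge_chain_def successively_conv_nth)
next
  assume c: "good_chain (n + 1) k c"
  have "\<forall>i. \<exists>B C. Suc i < length c \<longrightarrow> merges (n + 1) (c ! i) (c ! Suc i) B C \<and>
      (k + 1 < Min C \<longrightarrow> Min C - 1 \<in> B) \<and> (Min C = k + 1 \<longrightarrow> k \<notin> B)"
    using c by (auto simp: good_chain_def successively_conv_nth good_cover_def)
  then obtain B C where BC: "\<And>i. Suc i < length c \<Longrightarrow> merges (n + 1) (c ! i) (c ! Suc i) (B i) (C i)"
    and good: "\<And>i. Suc i < length c \<Longrightarrow>
      (k + 1 < Min (C i) \<longrightarrow> Min (C i) - 1 \<in> B i) \<and> (Min (C i) = k + 1 \<longrightarrow> k \<notin> B i)"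
    by metis
  have mc: "merge_chain (n + 1) c"
    using c BC by (auto simp: good_chain_def merge_chain_def)
  then have "length c = n + 1"
    using length_merge_chain by simp
  then have "chain_labels c \<in> PFk n k"
    using chain_labels_in_PFk_iff[OF mc BC, of k] good by simp
  then show "c \<in> chains_of n (PFk n k)"
    using mc by (simp add: chains_of_def nc_maxchains_iff)
qed

section \<open>The poset described by good paths\<close>

lemma rtrancl_if_successively:
  assumes "successively (\<lambda>x y. (x, y) \<in> R) p" "i \<le> j" "j < length p"
  shows "(p ! i, p ! j) \<in> R\<^sup>*"
  using assms(2,3)
proof (induction rule: dec_induct)
  case (step l)
  then show ?case
    using successively_nth[OF assms(1), of l] by (auto intro: rtrancl_into_rtrancl)
qed simp

lemma successively_if_rtrancl:
  assumes "(x, y) \<in> R\<^sup>*"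
  shows "\<exists>p. p \<noteq> [] \<and> hd p = x \<and> last p = y \<and> successively (\<lambda>x y. (x, y) \<in> R) p"
  using assms
proof (induction rule: converse_rtrancl_induct)
  case base
  show ?case by (rule exI[of _ "[y]"]) simp
next
  case (step x z)
  then obtain p where "p \<noteq> []" "hd p = z" "last p = y" "successively (\<lambda>x y. (x, y) \<in> R) p"
    by blast
  with step(1) show ?case
    by (intro exI[of _ "x # p"]) (auto simp: successively_Cons)
qed

lemma good_cover_on_good_chain:
  assumes "(bot_partition m, x) \<in> (good_cover m k)\<^sup>*" "(x, y) \<in> good_cover m k"
    "(y, top_partition m) \<in> (good_cover m k)\<^sup>*"
  obtains c i where "good_chain m k c" "Suc i < length c" "c ! i = x" "c ! Suc i = y"
proof -
  obtain p where p: "p \<noteq> []" "hd p = bot_partition m" "last p = x" "successively (\<lambda>x y. (x, y) \<in> good_cover m k) p"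
    using successively_if_rtrancl[OF assms(1)] by blast
  obtain q where q: "q \<noteq> []" "hd q = y" "last q = top_partition m" "successively (\<lambda>x y. (x, y) \<in> good_cover m k) q"
    using successively_if_rtrancl[OF assms(3)] by blast
  have "good_chain m k (p @ q)"
    using p q assms(2) by (simp add: good_chain_def successively_append_iff)
  moreover have "(p @ q) ! (length p - 1) = x" "(p @ q) ! Suc (length p - 1) = y"
    "Suc (length p - 1) < length (p @ q)"
    using p q by (auto simp: nth_append last_conv_nth hd_conv_nth)
  ultimately show ?thesis
    using that by blast
qed

lemma Poset_covers_PFk:
  "Poset_covers n (PFk n k) = {(x, y) \<in> good_cover (n + 1) k.
     (bot_partition (n + 1), x) \<in> (good_cover (n + 1) k)\<^sup>* \<and> (y, top_partition (n + 1)) \<in> (good_cover (n + 1) k)\<^sup>*}"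
proof (intro equalityI subrelI)
  fix x y assume "(x, y) \<in> Poset_covers n (PFk n k)"
  then obtain c i where c: "good_chain (n + 1) k c" "Suc i < length c" "x = c ! i" "y = c ! Suc i"
    unfolding Poset_covers_def chains_of_PFk_iff by blast
  then have s: "successively (\<lambda>x y. (x, y) \<in> good_cover (n + 1) k) c"
    "c ! 0 = bot_partition (n + 1)" "c ! (length c - 1) = top_partition (n + 1)"
    by (auto simp: good_chain_def hd_conv_nth last_conv_nth)
  show "(x, y) \<in> {(x, y) \<in> good_cover (n + 1) k.
     (bot_partition (n + 1), x) \<in> (good_cover (n + 1) k)\<^sup>* \<and> (y, top_partition (n + 1)) \<in> (good_cover (n + 1) k)\<^sup>*}"
    using rtrancl_if_successively[OF s(1), of 0 i] rtrancl_if_successively[OF s(1), of "Suc i" "length c - 1"]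
      successively_nth[OF s(1) c(2)] s(2,3) c(2-) by simp
next
  fix x y
  assume "(x, y) \<in> {(x, y) \<in> good_cover (n + 1) k.
     (bot_partition (n + 1), x) \<in> (good_cover (n + 1) k)\<^sup>* \<and> (y, top_partition (n + 1)) \<in> (good_cover (n + 1) k)\<^sup>*}"
  then obtain c i where "good_chain (n + 1) k c" "Suc i < length c" "c ! i = x" "c ! Suc i = y"
    using good_cover_on_good_chain by blast
  then show "(x, y) \<in> Poset_covers n (PFk n k)"
    unfolding Poset_covers_def chains_of_PFk_iff by blast
qed

lemma Poset_elems_PFk:
  "Poset_elems n (PFk n k) = {x. (bot_partition (n + 1), x) \<in> (good_cover (n + 1) k)\<^sup>* \<and>
     (x, top_partition (n + 1)) \<in> (good_cover (n + 1) k)\<^sup>*}"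
proof (intro equalityI subsetI)
  fix x assume "x \<in> Poset_elems n (PFk n k)"
  then obtain c i where c: "good_chain (n + 1) k c" "i < length c" "x = c ! i"
    by (auto simp: Poset_elems_def chains_of_PFk_iff in_set_conv_nth)
  then have s: "successively (\<lambda>x y. (x, y) \<in> good_cover (n + 1) k) c"
    "c ! 0 = bot_partition (n + 1)" "c ! (length c - 1) = top_partition (n + 1)"
    by (auto simp: good_chain_def hd_conv_nth last_conv_nth)
  show "x \<in> {x. (bot_partition (n + 1), x) \<in> (good_cover (n + 1) k)\<^sup>* \<and> (x, top_partition (n + 1)) \<in> (good_cover (n + 1) k)\<^sup>*}"
    using rtrancl_if_successively[OF s(1), of 0 i] rtrancl_if_successively[OF s(1), of i "length c - 1"]
      s(2,3) c(2-) by simp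
next
  fix x
  assume "x \<in> {x. (bot_partition (n + 1), x) \<in> (good_cover (n + 1) k)\<^sup>* \<and> (x, top_partition (n + 1)) \<in> (good_cover (n + 1) k)\<^sup>*}"
  then have x: "(bot_partition (n + 1), x) \<in> (good_cover (n + 1) k)\<^sup>*" "(x, top_partition (n + 1)) \<in> (good_cover (n + 1) k)\<^sup>*"
    by auto
  obtain p where p: "p \<noteq> []" "hd p = bot_partition (n + 1)" "last p = x" "successively (\<lambda>x y. (x, y) \<in> good_cover (n + 1) k) p"
    using successively_if_rtrancl[OF x(1)] by blast
  obtain q where q: "q \<noteq> []" "hd q = x" "last q = top_partition (n + 1)" "successively (\<lambda>x y. (x, y) \<in> good_cover (n + 1) k) q"
    using successively_if_rtrancl[OF x(2)] by blast
  \<comment> \<open>\<open>p\<close> ends and \<open>q\<close> begins with \<open>x\<close>, which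
    \<open>tl\<close> keeps from being repeated.\<close>
  have "good_chain (n + 1) k (p @ tl q)"
    using p q by (cases q) (auto simp: good_chain_def successively_append_iff successively_Cons split: if_splits)
  moreover have "x \<in> set (p @ tl q)"
    using p by auto
  ultimately show "x \<in> Poset_elems n (PFk n k)"
    unfolding Poset_elems_def chains_of_PFk_iff[symmetric] by blast
qed

text \<open>A good path between elements of the poset, prolonged to the bottom and to the top, is
  part of a good chain; hence all its covers occur in \<open>Poset_covers\<close>.\<close>

lemma Poset_order_PFk:
  "Poset_order n (PFk n k) = Restr ((good_cover (n + 1) k)\<^sup>*) (Poset_elems n (PFk n k))"
proof -
  let ?G = "good_cover (n + 1) k" and ?C = "Poset_covers n (PFk n k)"
  have "?C\<^sup>* \<subseteq> ?G\<^sup>*"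
    by (rule rtrancl_mono) (auto simp: Poset_covers_PFk)
  moreover have "(x, y) \<in> ?C\<^sup>*"
    if "(x, y) \<in> ?G\<^sup>*" "(bot_partition (n + 1), x) \<in> ?G\<^sup>*" "(y, top_partition (n + 1)) \<in> ?G\<^sup>*" for x y
    using that(1,3)
  proof (induction rule: rtrancl_induct)
    case (step y z)
    have "(y, z) \<in> ?C"
      using step(1,2,4) that(2) by (auto simp: Poset_covers_PFk intro: rtrancl_trans)
    moreover have "(x, y) \<in> ?C\<^sup>*"
      using step by (auto intro: converse_rtrancl_into_rtrancl)
    ultimately show ?case
      by (rule rtrancl_into_rtrancl[rotated])
  qed simp
  ultimately show ?thesis
    unfolding Poset_order_def by (auto simp: Poset_elems_PFk)
qed

theorem theorem3:
  fixes n k :: nat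
  assumes "1 < k" and "k \<le> n"
  shows "mobius_number (Poset_elems n (PFk n k)) (Poset_order n (PFk n k)) = 0"
proof -
  let ?b = "bot_partition (n + 1)" and ?t = "top_partition (n + 1)"
  let ?E = "Poset_elems n (PFk n k)" and ?r = "Poset_order n (PFk n k)"
  have bt: "(?b, ?t) \<in> (good_cover (n + 1) k)\<^sup>*"
    using assms by (intro bot_top_good_path) auto
  then have E: "?b \<in> ?E" "?t \<in> ?E"
    by (auto simp: Poset_elems_PFk)
  have le: "(?b, x) \<in> ?r" "(x, ?t) \<in> ?r" if "x \<in> ?E" for x
    using that E by (auto simp: Poset_order_PFk Poset_elems_PFk)
  have anti: "antisym ?r"
    using partial_order_Poset by (auto simp: partial_order_on_def)
  have "poset_min ?E ?r = ?b"
    unfolding poset_min_def using E le antisymD[OF anti] by (intro the_equality) auto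
  moreover have "poset_max ?E ?r = ?t"
    unfolding poset_max_def using E le antisymD[OF anti] by (intro the_equality) auto
  \<comment> \<open>\<open>{1..n + 1}\<close> is the only block of the top and contains both
    \<open>k\<close> and \<open>k + 1\<close>.\<close>
  moreover have "mobius ?E ?r ?b ?t = 0"
    using mobius_eq_0_if_joined[of "n + 1" k ?t "{1..n + 1}"] E(2) assms
      finite_Poset_elems[of n "PFk n k"] partial_order_Poset[of n "PFk n k"]
    by (simp add: Poset_order_PFk Poset_elems_PFk top_partition_def)
  ultimately show ?thesis
    by (simp add: mobius_number_def)
qed

end
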